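(* Let $N,k\ge 1$ be integers and let $K=K(x,x_0,y;t)$ be the heat kernel of the Grushin operator $\Delta_{\mathcal G}=\frac12(\Delta_x+|x|^2\Delta_y)$ on $\mathbb{R}^{N}\times\mathbb{R}^{k}$, given by the explicit formula in the context. If $1\le q\le\infty$, then there is a constant $C>0$ (independent of $x_0$ and $t$) such that $$\|K(\cdot,x_0,\cdot;t)\|_{L^q(\mathbb{R}^{N+k})}\le C\,t^{-\frac{N+2k}{2}\left(1-\frac1q\right)}$$ for every $x_0\in\mathbb{R}^N$ and every $t>0$, where the $L^q$ norm is taken in the variables $(x,y)\in\mathbb{R}^N\times\mathbb{R}^k$ (and $1/q=0$ if $q=\infty$).
   Context: For integers $N,k\ge1$, the heat kernel is, for $x,x_0\in\mathbb{R}^N$, $y\in\mathbb{R}^k$, $t>0$, $$K(x,x_0,y;t)=\frac{1}{(2\pi)^{\frac{N+2k}{2}}}\int_{\mathbb{R}^k}\left(\frac{|\xi|}{\sinh(|\xi|t)}\right)^{\frac N2}e^{\,i\xi\cdot y-\frac{|\xi|}{2}\left((|x|^2+|x_0|^2)\coth(|\xi|t)-2x\cdot x_0\,\operatorname{csch}(|\xi|t)\right)}\,d\xi ,$$ where $\operatorname{csch}=1/\sinh$. *)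

theory Defs
  imports "HOL-Analysis.Analysis" "HOL-Probability.Essential_Supremum"
begin

definition coth :: "real \<Rightarrow> real" where
  "coth x = cosh x / sinh x"

definition csch :: "real \<Rightarrow> real" where
  "csch x = 1 / sinh x"

(* Here N = CARD('n), k = CARD('k).  The integrand takes a junk value only at \<xi> = 0
   (from 0 / 0 = 0), which is a null set of R^k because k \<ge> 1. *)
definition grushin_heat_kernel ::
    "real ^ 'n \<Rightarrow> real ^ 'n \<Rightarrow> real ^ 'k \<Rightarrow> real \<Rightarrow> complex" where
  "grushin_heat_kernel x x0 y t =
     complex_of_real (1 / (2 * pi) powr ((real CARD('n) + 2 * real CARD('k)) / 2)) *
     (\<integral>\<xi>. complex_of_real ((norm \<xi> / sinh (norm \<xi> * t)) powr (real CARD('n) / 2)) *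
          exp (\<i> * complex_of_real (\<xi> \<bullet> y)
               - complex_of_real (norm \<xi> / 2 *
                   (((norm x)\<^sup>2 + (norm x0)\<^sup>2) * coth (norm \<xi> * t)
                     - 2 * (x \<bullet> x0) * csch (norm \<xi> * t))))
        \<partial>lborel)"

(* The L^q norm with values in [0, \<infinity>], meant for 1 \<le> q \<le> \<infinity>.  As for esssup, it is \<infinity> on
   non-measurable functions, so a finite bound includes membership in L^q.  The case
   distinction on I is the q-th root on [0, \<infinity>]. *)
definition Lq_norm :: "ennreal \<Rightarrow> 'a measure \<Rightarrow> ('a \<Rightarrow> 'b::real_normed_vector) \<Rightarrow> ennreal" where
  "Lq_norm q M f =
     (if f \<notin> borel_measurable M then \<infinity>
      else if q = \<infinity> then esssup M (\<lambda>z. ennreal (norm (f z)))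
      else let I = (\<integral>\<^sup>+ z. ennreal (norm (f z) powr enn2real q) \<partial>M)
           in if I = \<infinity> then \<infinity> else ennreal (enn2real I powr (1 / enn2real q)))"

end

theory Submission
  imports Defs "HOL-Probability.Probability"
begin

text \<open>
  Put \<open>a = |x - x0|\<^sup>2 / 2t\<close>, \<open>b = |x + x0|\<^sup>2 / 2t\<close> and \<open>s = t|\<xi>| / 2\<close>. The half-angle formulas turn the
  exponent into \<open>- a s coth s - b s tanh s\<close>, so that up to constants \<open>K\<close> is \<open>t\<^bsup>-N/2\<^esup> e\<^bsup>-a\<^esup>\<close> times the Fourier
  transform in \<open>\<xi>\<close> of the symbol \<open>(2s / sinh 2s)\<^bsup>N/2\<^esup> exp (- a (s coth s - 1)) exp (- b s tanh s)\<close>.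
  By the product formula for \<open>sinh\<close> every factor of the symbol is a limit of products of functions
  \<open>(1 + \<beta>|\<xi>|\<^sup>2)\<^bsup>-p\<^esup>\<close> and \<open>(1 + \<alpha>|\<xi>|\<^sup>2) / (1 + \<beta>|\<xi>|\<^sup>2)\<close> with \<open>\<alpha> \<le> \<beta>\<close>. These are mixtures of Gaussians in \<open>\<xi>\<close>,
  and hence of characters, so multiplication by the symbol does not increase the \<open>L\<^sup>1\<close> norm of Fourier
  transforms. Applied to \<open>exp (- \<epsilon>|\<xi>|\<^sup>2)\<close> with \<open>\<epsilon> \<rightarrow> 0\<close>, this bounds the \<open>L\<^sup>1\<close> norm of \<open>K\<close> in \<open>y\<close> by a
  multiple of \<open>t\<^bsup>-N/2\<^esup> e\<^bsup>-a\<^esup>\<close>, and integration over \<open>x\<close> gives the case \<open>q = 1\<close>. The case \<open>q = \<infinity>\<close> follows by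
  scaling \<open>\<xi>\<close>, and the others by interpolation.
\<close>

subsection \<open>Contractive Fourier multipliers\<close>

text \<open>The sign and the missing normalisation match the \<open>\<xi>\<close>-integral of the
  heat kernel, so powers of \<open>2 * pi\<close> appear in the norm bounds.\<close>

definition fourier_integral :: "('a::euclidean_space \<Rightarrow> complex) \<Rightarrow> 'a \<Rightarrow> complex" where
  "fourier_integral F y = (\<integral>\<xi>. F \<xi> * iexp (\<xi> \<bullet> y) \<partial>lborel)"

text \<open>Integrability is demanded because the integral of a non-integrable function is 0 by
  convention, which would make the bound vacuous.\<close>

definition fourier_L1_le :: "ennreal \<Rightarrow> ('a::euclidean_space \<Rightarrow> complex) \<Rightarrow> bool" where
  "fourier_L1_le B F \<longleftrightarrow> integrable lborel F \<and> (\<integral>\<^sup>+y. norm (fourier_integral F y) \<partial>lborel) \<le> B"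

text \<open>Satisfied by the Fourier transforms of probability measures, since convolution with such a
  measure contracts the \<open>L\<^sup>1\<close> norm.\<close>

definition fourier_multiplier :: "('a::euclidean_space \<Rightarrow> complex) \<Rightarrow> bool" where
  "fourier_multiplier g \<longleftrightarrow> g \<in> borel_measurable borel \<and> (AE \<xi> in lborel. norm (g \<xi>) \<le> 1) \<and>
     (\<forall>B F. fourier_L1_le B F \<longrightarrow> fourier_L1_le B (\<lambda>\<xi>. g \<xi> * F \<xi>))"

lemma measurable_fourier_integral [measurable]:
  fixes F :: "'a::euclidean_space \<Rightarrow> complex"
  assumes [measurable]: "F \<in> borel_measurable borel"
  shows "fourier_integral F \<in> borel_measurable borel"
  unfolding fourier_integral_def by measurable

text \<open>Dominated convergence gives pointwise convergence of the transforms, and Fatou's lemma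
  carries the bound over to the limit.\<close>

lemma fourier_L1_le_limit:
  fixes F :: "nat \<Rightarrow> 'a::euclidean_space \<Rightarrow> complex"
  assumes F: "\<And>n. fourier_L1_le B (F n)"
    and w: "integrable lborel w" "\<And>n. AE \<xi> in lborel. norm (F n \<xi>) \<le> w \<xi>"
    and lim: "AE \<xi> in lborel. (\<lambda>n. F n \<xi>) \<longlonglongrightarrow> G \<xi>"
    and G[measurable]: "G \<in> borel_measurable borel"
  shows "fourier_L1_le B G"
proof -
  have mF[measurable]: "F n \<in> borel_measurable borel" for n
    using F[of n] by (auto simp: fourier_L1_le_def)
  have [measurable]: "w \<in> borel_measurable borel"
    using w(1) by auto
  have "(\<lambda>n. fourier_integral (F n) y) \<longlonglongrightarrow> fourier_integral G y" for y
    unfolding fourier_integral_def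
  proof (rule integral_dominated_convergence[where w=w])
    show "AE \<xi> in lborel. (\<lambda>n. F n \<xi> * iexp (\<xi> \<bullet> y)) \<longlonglongrightarrow> G \<xi> * iexp (\<xi> \<bullet> y)"
      using lim by eventually_elim (intro tendsto_intros)
    show "AE \<xi> in lborel. norm (F n \<xi> * iexp (\<xi> \<bullet> y)) \<le> w \<xi>" for n
      using w(2)[of n] by (simp add: norm_mult)
  qed (use w in auto)
  then have "(\<lambda>n. ennreal (norm (fourier_integral (F n) y))) \<longlonglongrightarrow> ennreal (norm (fourier_integral G y))" for y
    by (intro tendsto_ennrealI tendsto_norm)
  then have "ennreal (norm (fourier_integral G y)) =
      liminf (\<lambda>n. ennreal (norm (fourier_integral (F n) y)))" for y
    by (intro lim_imp_Liminf[symmetric]) auto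
  then have "(\<integral>\<^sup>+y. norm (fourier_integral G y) \<partial>lborel) =
      (\<integral>\<^sup>+y. liminf (\<lambda>n. ennreal (norm (fourier_integral (F n) y))) \<partial>lborel)"
    by simp
  also have "\<dots> \<le> liminf (\<lambda>n. \<integral>\<^sup>+y. ennreal (norm (fourier_integral (F n) y)) \<partial>lborel)"
    by (intro nn_integral_liminf) simp
  also have "\<dots> \<le> B"
    using F by (intro Liminf_le always_eventually allI) (auto simp: fourier_L1_le_def)
  finally have "(\<integral>\<^sup>+y. norm (fourier_integral G y) \<partial>lborel) \<le> B" .
  moreover have "integrable lborel G"
    by (rule integrable_dominated_convergence[where w=w and s=F]) (use w lim in auto)
  ultimately show ?thesis
    by (simp add: fourier_L1_le_def)
qed

lemma fourier_multiplierD: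
  assumes "fourier_multiplier g"
  shows "g \<in> borel_measurable borel" "AE \<xi> in lborel. norm (g \<xi>) \<le> 1"
    "fourier_L1_le B F \<Longrightarrow> fourier_L1_le B (\<lambda>\<xi>. g \<xi> * F \<xi>)"
  using assms by (auto simp: fourier_multiplier_def)

lemma fourier_multiplier_one [simp]: "fourier_multiplier (\<lambda>_. 1)"
  by (simp add: fourier_multiplier_def)

lemma fourier_multiplier_mult:
  assumes f: "fourier_multiplier f" and g: "fourier_multiplier g"
  shows "fourier_multiplier (\<lambda>\<xi>. f \<xi> * g \<xi>)"
proof -
  have [measurable]: "f \<in> borel_measurable borel" "g \<in> borel_measurable borel"
    using f g by (auto simp: fourier_multiplier_def)
  have "AE \<xi> in lborel. norm (f \<xi> * g \<xi>) \<le> 1"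
    using fourier_multiplierD(2)[OF f] fourier_multiplierD(2)[OF g]
    by eventually_elim (simp add: norm_mult mult_le_one)
  moreover have "fourier_L1_le B (\<lambda>\<xi>. f \<xi> * g \<xi> * F \<xi>)" if "fourier_L1_le B F" for B F
    using fourier_multiplierD(3)[OF f fourier_multiplierD(3)[OF g that]] by (simp add: mult.assoc)
  ultimately show ?thesis
    by (simp add: fourier_multiplier_def)
qed

lemma fourier_multiplier_prod:
  assumes "\<And>i. i \<in> I \<Longrightarrow> fourier_multiplier (g i)"
  shows "fourier_multiplier (\<lambda>\<xi>. \<Prod>i\<in>I. g i \<xi>)"
  using assms by (induction I rule: infinite_finite_induct) (auto intro: fourier_multiplier_mult)

lemma fourier_multiplier_power:
  assumes "fourier_multiplier g"
  shows "fourier_multiplier (\<lambda>\<xi>. g \<xi> ^ n)"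
  using fourier_multiplier_prod[of "{..<n}" "\<lambda>_. g"] assms by simp

text \<open>The bound 1 built into multipliers makes \<open>norm (F \<xi>)\<close> a dominating
  function for all \<open>n\<close> at once.\<close>

lemma fourier_multiplier_limit:
  fixes g :: "nat \<Rightarrow> 'a::euclidean_space \<Rightarrow> complex"
  assumes g: "\<And>n. fourier_multiplier (g n)"
    and lim: "AE \<xi> in lborel. (\<lambda>n. g n \<xi>) \<longlonglongrightarrow> h \<xi>"
    and h[measurable]: "h \<in> borel_measurable borel"
  shows "fourier_multiplier h"
proof -
  have bd: "AE \<xi> in lborel. \<forall>n. norm (g n \<xi>) \<le> 1"
    unfolding AE_all_countable using g by (auto simp: fourier_multiplier_def)
  have "AE \<xi> in lborel. norm (h \<xi>) \<le> 1"
    using bd lim by eventually_elim (rule LIMSEQ_le_const2[OF tendsto_norm], auto)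
  moreover have "fourier_L1_le B (\<lambda>\<xi>. h \<xi> * F \<xi>)" if F: "fourier_L1_le B F" for B F
  proof -
    have iF: "integrable lborel F"
      using F by (simp add: fourier_L1_le_def)
    then have [measurable]: "F \<in> borel_measurable borel" by auto
    show ?thesis
    proof (rule fourier_L1_le_limit[where F = "\<lambda>n \<xi>. g n \<xi> * F \<xi>" and w = "\<lambda>\<xi>. norm (F \<xi>)"])
      show "fourier_L1_le B (\<lambda>\<xi>. g n \<xi> * F \<xi>)" for n
        using fourier_multiplierD(3)[OF g F] .
      show "integrable lborel (\<lambda>\<xi>. norm (F \<xi>))"
        using iF by simp
      show "AE \<xi> in lborel. norm (g n \<xi> * F \<xi>) \<le> norm (F \<xi>)" for n
        using fourier_multiplierD(2)[OF g[of n]]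
        by eventually_elim (simp add: norm_mult mult_left_le_one_le)
      show "AE \<xi> in lborel. (\<lambda>n. g n \<xi> * F \<xi>) \<longlonglongrightarrow> h \<xi> * F \<xi>"
        using lim by eventually_elim (intro tendsto_intros)
    qed measurable
  qed
  ultimately show ?thesis
    by (simp add: fourier_multiplier_def)
qed

text \<open>Fubini moves the average over \<open>\<omega>\<close> outside the transform; the
  triangle inequality and Tonelli then average the individual L^1 bounds against a measure of mass
  1. The bound \<open>bd\<close> holds at every \<open>\<xi>\<close>, so that each average
  exists.\<close>

lemma fourier_multiplier_mixture:
  fixes g :: "'b \<Rightarrow> 'a::euclidean_space \<Rightarrow> complex"
  assumes M: "prob_space M"
    and g: "\<And>\<omega>. \<omega> \<in> space M \<Longrightarrow> fourier_multiplier (g \<omega>)"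
    and bd: "\<And>\<omega> \<xi>. \<omega> \<in> space M \<Longrightarrow> norm (g \<omega> \<xi>) \<le> 1"
    and mg[measurable]: "(\<lambda>(\<xi>, \<omega>). g \<omega> \<xi>) \<in> borel_measurable (borel \<Otimes>\<^sub>M M)"
  shows "fourier_multiplier (\<lambda>\<xi>. \<integral>\<omega>. g \<omega> \<xi> \<partial>M)"
proof -
  interpret M: prob_space M by fact
  interpret P: pair_sigma_finite lborel M ..
  have mg': "(\<lambda>\<omega>. g \<omega> \<xi>) \<in> borel_measurable M" for \<xi>
    by measurable
  have int_g: "integrable M (\<lambda>\<omega>. g \<omega> \<xi>)" for \<xi>
    using mg' bd by (intro M.integrable_const_bound[where B=1]) auto
  have "norm (\<integral>\<omega>. g \<omega> \<xi> \<partial>M) \<le> 1" for \<xi>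
  proof -
    have "norm (\<integral>\<omega>. g \<omega> \<xi> \<partial>M) \<le> (\<integral>\<omega>. norm (g \<omega> \<xi>) \<partial>M)" by simp
    also have "\<dots> \<le> (\<integral>\<omega>. 1 \<partial>M)"
      using bd int_g by (intro integral_mono) auto
    finally show ?thesis by (simp add: M.prob_space)
  qed
  moreover have "fourier_L1_le B (\<lambda>\<xi>. (\<integral>\<omega>. g \<omega> \<xi> \<partial>M) * F \<xi>)" if F: "fourier_L1_le B F" for B F
  proof -
    have iF: "integrable lborel F"
      using F by (simp add: fourier_L1_le_def)
    then have [measurable]: "F \<in> borel_measurable borel" by auto
    have iP: "integrable (lborel \<Otimes>\<^sub>M M) (\<lambda>(\<xi>, \<omega>). g \<omega> \<xi> * F \<xi> * iexp (\<xi> \<bullet> y))" for y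
    proof (rule Bochner_Integration.integrable_bound)
      have "integrable (lborel \<Otimes>\<^sub>M M) (\<lambda>(\<xi>, \<omega>). F \<xi>)"
        using iF by (intro P.Fubini_integrable) (auto simp: M.prob_space)
      then show "integrable (lborel \<Otimes>\<^sub>M M) (\<lambda>(\<xi>, \<omega>). norm (F \<xi>))"
        by (simp add: case_prod_unfold)
      show "AE p in lborel \<Otimes>\<^sub>M M. norm (case p of (\<xi>, \<omega>) \<Rightarrow> g \<omega> \<xi> * F \<xi> * iexp (\<xi> \<bullet> y))
          \<le> norm (case p of (\<xi>, \<omega>) \<Rightarrow> norm (F \<xi>))"
        using bd by (intro AE_I2) (auto simp: space_pair_measure norm_mult mult_left_le_one_le)
    qed measurable
    have eq: "fourier_integral (\<lambda>\<xi>. (\<integral>\<omega>. g \<omega> \<xi> \<partial>M) * F \<xi>) y =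
        (\<integral>\<omega>. fourier_integral (\<lambda>\<xi>. g \<omega> \<xi> * F \<xi>) y \<partial>M)" for y
    proof -
      have "fourier_integral (\<lambda>\<xi>. (\<integral>\<omega>. g \<omega> \<xi> \<partial>M) * F \<xi>) y =
          (\<integral>\<xi>. (\<integral>\<omega>. g \<omega> \<xi> * F \<xi> * iexp (\<xi> \<bullet> y) \<partial>M) \<partial>lborel)"
        unfolding fourier_integral_def by (simp add: mult.assoc)
      also have "\<dots> = (\<integral>\<omega>. (\<integral>\<xi>. g \<omega> \<xi> * F \<xi> * iexp (\<xi> \<bullet> y) \<partial>lborel) \<partial>M)"
        using P.Fubini_integral[OF iP] by simp
      finally show ?thesis by (simp add: fourier_integral_def)
    qed
    have [measurable]: "(\<lambda>(y, \<omega>). fourier_integral (\<lambda>\<xi>. g \<omega> \<xi> * F \<xi>) y) \<in> borel_measurable (borel \<Otimes>\<^sub>M M)"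
      unfolding fourier_integral_def by measurable
    have "(\<integral>\<^sup>+y. norm (fourier_integral (\<lambda>\<xi>. (\<integral>\<omega>. g \<omega> \<xi> \<partial>M) * F \<xi>) y) \<partial>lborel)
        \<le> (\<integral>\<^sup>+y. (\<integral>\<^sup>+\<omega>. norm (fourier_integral (\<lambda>\<xi>. g \<omega> \<xi> * F \<xi>) y) \<partial>M) \<partial>lborel)"
      unfolding eq
    proof (intro nn_integral_mono)
      fix y
      show "ennreal (norm (\<integral>\<omega>. fourier_integral (\<lambda>\<xi>. g \<omega> \<xi> * F \<xi>) y \<partial>M))
          \<le> (\<integral>\<^sup>+\<omega>. norm (fourier_integral (\<lambda>\<xi>. g \<omega> \<xi> * F \<xi>) y) \<partial>M)"
        \<comment> \<open>In the non-integrable case the left-hand side is 0 by convention.\<close>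
        by (cases "integrable M (\<lambda>\<omega>. fourier_integral (\<lambda>\<xi>. g \<omega> \<xi> * F \<xi>) y)")
           (auto intro: integral_norm_bound_ennreal simp: not_integrable_integral_eq)
    qed
    also have "\<dots> = (\<integral>\<^sup>+\<omega>. (\<integral>\<^sup>+y. norm (fourier_integral (\<lambda>\<xi>. g \<omega> \<xi> * F \<xi>) y) \<partial>lborel) \<partial>M)"
      by (rule P.Fubini'[symmetric]) measurable
    also have "\<dots> \<le> (\<integral>\<^sup>+\<omega>. B \<partial>M)"
      using fourier_multiplierD(3)[OF g F]
      by (intro nn_integral_mono) (auto simp: fourier_L1_le_def)
    also have "\<dots> = B"
      by (simp add: M.emeasure_space_1)
    finally have "(\<integral>\<^sup>+y. norm (fourier_integral (\<lambda>\<xi>. (\<integral>\<omega>. g \<omega> \<xi> \<partial>M) * F \<xi>) y) \<partial>lborel) \<le> B" .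
    moreover have "integrable lborel (\<lambda>\<xi>. (\<integral>\<omega>. g \<omega> \<xi> \<partial>M) * F \<xi>)"
      by (rule Bochner_Integration.integrable_bound[OF iF])
         (auto intro!: AE_I2 mult_left_le_one_le simp: norm_mult \<open>\<And>\<xi>. norm (\<integral>\<omega>. g \<omega> \<xi> \<partial>M) \<le> 1\<close>)
    ultimately show ?thesis
      by (simp add: fourier_L1_le_def)
  qed
  ultimately show ?thesis
    by (simp add: fourier_multiplier_def)
qed

subsection \<open>Mixtures of Gaussians\<close>

text \<open>A character translates the transform by \<open>a\<close>, and Lebesgue measure is
  translation invariant.\<close>

lemma fourier_multiplier_character:
  fixes a :: "'a::euclidean_space"
  shows "fourier_multiplier (\<lambda>\<xi>. iexp (\<xi> \<bullet> a))"
proof -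
  have "fourier_L1_le B (\<lambda>\<xi>. iexp (\<xi> \<bullet> a) * F \<xi>)" if F: "fourier_L1_le B F" for B and F :: "'a \<Rightarrow> complex"
  proof -
    have iF: "integrable lborel F"
      using F by (simp add: fourier_L1_le_def)
    then have [measurable]: "F \<in> borel_measurable borel" by auto
    have "fourier_integral (\<lambda>\<xi>. iexp (\<xi> \<bullet> a) * F \<xi>) y = fourier_integral F (a + y)" for y
      unfolding fourier_integral_def
      by (intro Bochner_Integration.integral_cong) (auto simp: inner_add_right exp_add ring_distribs)
    then have "(\<integral>\<^sup>+y. norm (fourier_integral (\<lambda>\<xi>. iexp (\<xi> \<bullet> a) * F \<xi>) y) \<partial>lborel) =
        (\<integral>\<^sup>+y. norm (fourier_integral F (a + y)) \<partial>lborel)"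
      by simp
    also have "\<dots> = (\<integral>\<^sup>+y. norm (fourier_integral F y) \<partial>distr lborel borel ((+) a))"
      by (subst nn_integral_distr) auto
    also have "\<dots> = (\<integral>\<^sup>+y. norm (fourier_integral F y) \<partial>lborel)"
      by (simp add: lborel_distr_plus)
    also have "\<dots> \<le> B"
      using F by (simp add: fourier_L1_le_def)
    finally have "(\<integral>\<^sup>+y. norm (fourier_integral (\<lambda>\<xi>. iexp (\<xi> \<bullet> a) * F \<xi>) y) \<partial>lborel) \<le> B" .
    moreover have "integrable lborel (\<lambda>\<xi>. iexp (\<xi> \<bullet> a) * F \<xi>)"
      by (rule Bochner_Integration.integrable_bound[OF iF]) (auto simp: norm_mult)
    ultimately show ?thesis
      by (simp add: fourier_L1_le_def)
  qed
  then show ?thesis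
    by (simp add: fourier_multiplier_def)
qed

text \<open>This Gaussian is the characteristic function of the standard normal law at
  \<open>\<xi> \<bullet> b\<close>, hence a mixture of the characters with frequencies
  \<open>z *\<^sub>R b\<close>.\<close>

lemma fourier_multiplier_gaussian_inner:
  fixes b :: "'a::euclidean_space"
  shows "fourier_multiplier (\<lambda>\<xi>. of_real (exp (- ((\<xi> \<bullet> b)\<^sup>2 / 2))))"
proof -
  interpret N: real_distribution std_normal_distribution
    by (rule real_dist_normal_dist)
  have "fourier_multiplier (\<lambda>\<xi>. \<integral>z. iexp (\<xi> \<bullet> (z *\<^sub>R b)) \<partial>std_normal_distribution)"
    by (intro fourier_multiplier_mixture fourier_multiplier_character N.prob_space_axioms) auto
  moreover have "(\<integral>z. iexp (\<xi> \<bullet> (z *\<^sub>R b)) \<partial>std_normal_distribution) = of_real (exp (- ((\<xi> \<bullet> b)\<^sup>2 / 2)))" for \<xi>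
    using fun_cong[OF char_std_normal_distribution, of "\<xi> \<bullet> b"]
    by (simp add: char_def mult.commute)
  ultimately show ?thesis
    by simp
qed

lemma fourier_multiplier_gaussian:
  fixes u :: real
  assumes "u \<ge> 0"
  shows "fourier_multiplier (\<lambda>\<xi>::'a::euclidean_space. of_real (exp (- (u * (norm \<xi>)\<^sup>2))))"
proof -
  \<comment> \<open>The factor \<open>sqrt (2 * u)\<close> turns the exponent 1/2 of the normal law
    into \<open>u\<close> in each coordinate.\<close>
  have "fourier_multiplier (\<lambda>\<xi>::'a. \<Prod>b\<in>Basis. of_real (exp (- ((\<xi> \<bullet> (sqrt (2 * u) *\<^sub>R b))\<^sup>2 / 2))))"
    by (intro fourier_multiplier_prod fourier_multiplier_gaussian_inner)
  moreover have "(\<Prod>b\<in>Basis. of_real (exp (- ((\<xi> \<bullet> (sqrt (2 * u) *\<^sub>R b))\<^sup>2 / 2)))) =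
      complex_of_real (exp (- (u * (norm \<xi>)\<^sup>2)))" for \<xi> :: 'a
  proof -
    have "(\<Sum>b\<in>Basis. (\<xi> \<bullet> (sqrt (2 * u) *\<^sub>R b))\<^sup>2 / 2) = u * (norm \<xi>)\<^sup>2"
      using assms unfolding power2_norm_eq_inner euclidean_inner[of \<xi> \<xi>] sum_distrib_left
      by (intro sum.cong) (auto simp: power_mult_distrib power2_eq_square)
    then show ?thesis
      by (simp add: exp_sum[symmetric] sum_negf flip: of_real_prod)
  qed
  ultimately show ?thesis
    by simp
qed

section \<open>Gamma mixtures: powers and quotients of
  \<open>1 + b * (norm \<xi>)\<^sup>2\<close>\<close>

text \<open>The Laplace transform of the Gamma law of shape \<open>p\<close>, by substituting
  \<open>c * u\<close> in Euler's integral. The value \<open>c = 1\<close> gives total mass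
  1.\<close>

lemma nn_integral_Gamma_scaled:
  fixes p c :: real
  assumes "p > 0" "c > 0"
  shows "(\<integral>\<^sup>+u. ennreal (indicator {0..} u * u powr (p - 1) / Gamma p * exp (- (c * u))) \<partial>lborel) =
    ennreal (c powr - p)"
proof -
  have G: "Gamma p > 0" "Gamma p \<noteq> 0" using Gamma_real_pos[OF assms(1)] by (simp_all only: less_numeral_extra order_less_imp_not_eq2 not_False_eq_True)
  have "ennreal (Gamma p) = ennreal \<bar>c\<bar> * (\<integral>\<^sup>+u. ennreal (indicator {0..} (0 + c * u) * (0 + c * u) powr (p - 1) / exp (0 + c * u)) \<partial>lborel)"
    unfolding Gamma_conv_nn_integral_real[OF assms(1)]
    using assms by (intro nn_integral_real_affine) auto
  also have "(\<integral>\<^sup>+u. ennreal (indicator {0..} (0 + c * u) * (0 + c * u) powr (p - 1) / exp (0 + c * u)) \<partial>lborel)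
      = (\<integral>\<^sup>+u. ennreal (Gamma p * c powr (p - 1)) * ennreal (indicator {0..} u * u powr (p - 1) / Gamma p * exp (- (c * u))) \<partial>lborel)"
    using assms G
    by (intro nn_integral_cong)
       (auto simp: indicator_def zero_le_mult_iff powr_mult exp_minus field_simps simp flip: ennreal_mult)
  also have "\<dots> = ennreal (Gamma p * c powr (p - 1)) * (\<integral>\<^sup>+u. ennreal (indicator {0..} u * u powr (p - 1) / Gamma p * exp (- (c * u))) \<partial>lborel)"
    by (rule nn_integral_cmult) measurable
  finally have eq: "ennreal (Gamma p) = ennreal (c * (Gamma p * c powr (p - 1))) * (\<integral>\<^sup>+u. ennreal (indicator {0..} u * u powr (p - 1) / Gamma p * exp (- (c * u))) \<partial>lborel)"
    using assms G by (simp add: ennreal_mult mult.assoc)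
  have c: "c * (Gamma p * c powr (p - 1)) = Gamma p * c powr p"
    using assms by (simp add: powr_diff)
  have "ennreal (c powr - p) = ennreal (c powr -p / Gamma p) * ennreal (Gamma p)"
    using assms G by (simp flip: ennreal_mult)
  also have "\<dots> = ennreal (c powr -p / Gamma p * (Gamma p * c powr p)) * (\<integral>\<^sup>+u. ennreal (indicator {0..} u * u powr (p - 1) / Gamma p * exp (- (c * u))) \<partial>lborel)"
  proof -
    have "c powr -p / Gamma p \<ge> 0" "Gamma p * c powr p \<ge> 0"
      using G(1) by (simp_all add: less_imp_le)
    then show ?thesis
      unfolding eq c by (simp only: ennreal_mult mult.assoc)
  qed
  also have "c powr -p / Gamma p * (Gamma p * c powr p) = 1"
    using assms G by (simp add: powr_minus field_simps)
  finally show ?thesis by simp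
qed

text \<open>Subordination: the function is the average of the Gaussians
  \<open>exp (- (u * b * (norm \<xi>)\<^sup>2))\<close> over a Gamma distributed
  \<open>u\<close>.\<close>

lemma fourier_multiplier_resolvent:
  fixes p b :: real
  assumes p: "p > 0" and b: "b \<ge> 0"
  shows "fourier_multiplier (\<lambda>\<xi>::'a::euclidean_space. of_real ((1 + b * (norm \<xi>)\<^sup>2) powr - p))"
proof -
  define f where "f u = indicator {0..} u * u powr (p - 1) / Gamma p * exp (- u)" for u :: real
  have f0: "f u \<ge> 0" for u
    using p by (auto simp: f_def less_imp_le)
  have [measurable]: "f \<in> borel_measurable borel"
    unfolding f_def by measurable
  define M where "M = density lborel f"
  have "prob_space M"
    using nn_integral_Gamma_scaled[OF p, of 1] unfolding M_def
    by (intro prob_spaceI) (simp add: emeasure_density f_def)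
  have [measurable_cong]: "sets M = sets borel"
    by (simp add: M_def)
  \<comment> \<open>The mixture rule asks for a multiplier at every real \<open>u\<close>; the
    absolute value provides this and changes nothing on the support of the density.\<close>
  have "fourier_multiplier (\<lambda>\<xi>::'a. \<integral>u. of_real (exp (- ((\<bar>u\<bar> * b) * (norm \<xi>)\<^sup>2))) \<partial>M)"
    using b by (intro fourier_multiplier_mixture fourier_multiplier_gaussian \<open>prob_space M\<close>) auto
  moreover have "(\<integral>u. of_real (exp (- ((\<bar>u\<bar> * b) * (norm \<xi>)\<^sup>2))) \<partial>M) =
      complex_of_real ((1 + b * (norm \<xi>)\<^sup>2) powr - p)" for \<xi> :: 'a
  proof -
    have pos: "1 + b * (norm \<xi>)\<^sup>2 > 0"
      using b by (intro add_pos_nonneg) auto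
    have "(\<integral>u. exp (- ((\<bar>u\<bar> * b) * (norm \<xi>)\<^sup>2)) \<partial>M) =
        (\<integral>u. f u * exp (- ((\<bar>u\<bar> * b) * (norm \<xi>)\<^sup>2)) \<partial>lborel)"
      unfolding M_def using f0 by (subst integral_density) auto
    also have "\<dots> = (1 + b * (norm \<xi>)\<^sup>2) powr - p"
    proof (rule integral_eq_nn_integral[THEN trans])
      have "(\<integral>\<^sup>+u. ennreal (f u * exp (- ((\<bar>u\<bar> * b) * (norm \<xi>)\<^sup>2))) \<partial>lborel) =
        (\<integral>\<^sup>+u. ennreal (indicator {0..} u * u powr (p - 1) / Gamma p * exp (- ((1 + b * (norm \<xi>)\<^sup>2) * u))) \<partial>lborel)"
        by (intro nn_integral_cong arg_cong[where f=ennreal])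
           (auto simp: f_def indicator_def algebra_simps simp flip: exp_add)
      then show "enn2real (\<integral>\<^sup>+u. ennreal (f u * exp (- ((\<bar>u\<bar> * b) * (norm \<xi>)\<^sup>2))) \<partial>lborel) = (1 + b * (norm \<xi>)\<^sup>2) powr - p"
        by (simp only: nn_integral_Gamma_scaled[OF p pos]) simp
    qed (use f0 in auto)
    finally show ?thesis
      by (subst integral_complex_of_real) simp
  qed
  ultimately show ?thesis
    by simp
qed

text \<open>A mixture of the multipliers 1 and \<open>g\<close> decided by a biased coin.\<close>

lemma fourier_multiplier_convex_one:
  assumes g: "fourier_multiplier g" "\<And>\<xi>. norm (g \<xi>) \<le> 1" and r: "0 \<le> r" "r \<le> 1"
  shows "fourier_multiplier (\<lambda>\<xi>::'a::euclidean_space. of_real r + of_real (1 - r) * g \<xi>)"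
proof -
  have [measurable]: "g \<in> borel_measurable borel"
    using g by (simp add: fourier_multiplier_def)
  have "fourier_multiplier (\<lambda>\<xi>::'a. \<integral>b. (if b then 1 else g \<xi>) \<partial>measure_pmf (bernoulli_pmf r))"
  proof (intro fourier_multiplier_mixture measure_pmf.prob_space_axioms)
    show "fourier_multiplier (\<lambda>\<xi>. if b then 1 else g \<xi>)" for b
      using g by (cases b) auto
  qed (use g in \<open>auto split: if_splits\<close>)
  moreover have "(\<integral>b. (if b then 1 else g \<xi>) \<partial>measure_pmf (bernoulli_pmf r)) = of_real r + of_real (1 - r) * g \<xi>" for \<xi>
    using r by (subst integral_measure_pmf[of UNIV]) (auto simp: UNIV_bool scaleR_conv_of_real)
  ultimately show ?thesis
    by simp
qed

text \<open>For \<open>b > 0\<close> the quotient equals \<open>a / b\<close> plus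
  \<open>1 - a / b\<close> times the resolvent, and \<open>a \<le> b\<close> makes this a convex
  combination. For \<open>b = 0\<close> it is constantly 1.\<close>

lemma fourier_multiplier_ratio:
  fixes a b :: real
  assumes "0 \<le> a" "a \<le> b"
  shows "fourier_multiplier (\<lambda>\<xi>::'a::euclidean_space. of_real ((1 + a * (norm \<xi>)\<^sup>2) / (1 + b * (norm \<xi>)\<^sup>2)))"
proof (cases "b = 0")
  case False
  then have b: "b > 0" using assms by simp
  have pos: "1 + b * (norm \<xi>)\<^sup>2 \<ge> 1" for \<xi> :: 'a
    using b by simp
  have "fourier_multiplier (\<lambda>\<xi>::'a. of_real (a / b) + of_real (1 - a / b) * of_real ((1 + b * (norm \<xi>)\<^sup>2) powr - 1))"
  proof (intro fourier_multiplier_convex_one fourier_multiplier_resolvent)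
    fix \<xi> :: 'a
    show "norm (complex_of_real ((1 + b * (norm \<xi>)\<^sup>2) powr - 1)) \<le> 1"
      unfolding norm_of_real using powr_mono[of "-1" 0 "1 + b * (norm \<xi>)\<^sup>2"] pos[of \<xi>]
      by (simp del: powr_minus_divide) linarith?
  qed (use assms b in auto)
  moreover have "a / b + (1 - a / b) * (1 + b * (norm \<xi>)\<^sup>2) powr - 1 =
      (1 + a * (norm \<xi>)\<^sup>2) / (1 + b * (norm \<xi>)\<^sup>2)" for \<xi> :: 'a
  proof -
    define D where "D = 1 + b * (norm \<xi>)\<^sup>2"
    have D: "D > 0" "(norm \<xi>)\<^sup>2 = (D - 1) / b"
      using pos[of \<xi>] b unfolding D_def by (linarith, simp)
    show ?thesis
      unfolding D_def[symmetric] unfolding D(2) using D(1) b by (simp add: powr_neg_one field_simps)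
  qed
  ultimately show ?thesis
    by (simp only: flip: of_real_add of_real_mult)
qed (use assms in simp)

subsection \<open>Hyperbolic functions\<close>

lemma borel_measurable_sinh [measurable]: "(sinh :: real \<Rightarrow> real) \<in> borel_measurable borel"
  by (intro borel_measurable_continuous_onI continuous_intros)

lemma borel_measurable_cosh [measurable]: "(cosh :: real \<Rightarrow> real) \<in> borel_measurable borel"
  by (intro borel_measurable_continuous_onI continuous_intros)

section \<open>Infinite products for \<open>sinh\<close> and \<open>cosh\<close>\<close>

text \<open>Euler's sine product, evaluated on the imaginary axis.\<close>

lemma sinh_product_formula:
  fixes x :: real
  assumes "x \<noteq> 0"
  shows "(\<lambda>n. \<Prod>k=1..n. 1 + (x / (pi * real k))\<^sup>2) \<longlonglongrightarrow> sinh x / x"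
proof -
  have eq: "complex_of_real pi * (\<i> * of_real (x / pi)) * (\<Prod>k=1..n. 1 - (\<i> * of_real (x / pi))\<^sup>2 / of_nat k ^ 2) =
      \<i> * of_real (x * (\<Prod>k=1..n. 1 + (x / (pi * real k))\<^sup>2))" for n
    by (simp add: power_mult_distrib power_divide)
  have "sin (complex_of_real pi * (\<i> * of_real (x / pi))) = \<i> * of_real (sinh x)"
    by (simp add: sin_i_times sinh_field_def exp_minus exp_of_real)
  with sin_product_formula_complex[of "\<i> * of_real (x / pi)"]
  have "(\<lambda>n. \<i> * of_real (x * (\<Prod>k=1..n. 1 + (x / (pi * real k))\<^sup>2))) \<longlonglongrightarrow> \<i> * of_real (sinh x)"
    by (simp only: eq)
  from tendsto_Im[OF this] have "(\<lambda>n. x * (\<Prod>k=1..n. 1 + (x / (pi * real k))\<^sup>2)) \<longlonglongrightarrow> sinh x"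
    by (simp only: Im_i_times Re_complex_of_real)
  from tendsto_divide[OF this tendsto_const[of x]] assms show ?thesis
    by simp
qed

text \<open>Since \<open>cosh x\<close> is the quotient of \<open>sinh (2 * x) / (2 * x)\<close> by
  \<open>sinh x / x\<close>, the even-indexed factors of the product at \<open>2 * x\<close> cancel
  against the product at \<open>x\<close>, and the odd-indexed ones remain.\<close>

lemma cosh_product_formula:
  fixes x :: real
  assumes "x \<noteq> 0"
  shows "(\<lambda>n. \<Prod>j<n. 1 + (2 * x / (pi * real (2 * j + 1)))\<^sup>2) \<longlonglongrightarrow> cosh x"
proof -
  let ?P = "\<lambda>x n. \<Prod>k=1..n. 1 + (x / (pi * real k))\<^sup>2"
  have pos: "?P x n > 0" for n
    by (intro prod_pos) (auto intro: add_pos_nonneg)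
  have "?P (2 * x) (2 * n) = ?P x n * (\<Prod>j<n. 1 + (2 * x / (pi * real (2 * j + 1)))\<^sup>2)" for n
  proof (induction n)
    case (Suc n)
    have "(2 * x / (pi * real (2 * Suc n)))\<^sup>2 = (x / (pi * real (Suc n)))\<^sup>2"
    proof -
      have "real (2 * Suc n) = 2 * real (Suc n)"
        by simp
      then show ?thesis
        by (simp only:) (simp add: field_simps del: of_nat_Suc)
    qed
    moreover have "?P (2 * x) (2 * Suc n) = ?P (2 * x) (2 * n) *
        (1 + (2 * x / (pi * real (2 * n + 1)))\<^sup>2) * (1 + (2 * x / (pi * real (2 * Suc n)))\<^sup>2)"
      by (simp add: prod.nat_ivl_Suc')
    ultimately show ?case
      unfolding Suc.IH by (auto simp: prod.nat_ivl_Suc')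
  qed simp
  then have eq: "?P (2 * x) (2 * n) / ?P x n = (\<Prod>j<n. 1 + (2 * x / (pi * real (2 * j + 1)))\<^sup>2)" for n
    using pos[of n] by (simp only: nonzero_mult_div_cancel_left less_imp_neq[symmetric] not_False_eq_True)
  have "(\<lambda>n. ?P (2 * x) (2 * n)) \<longlonglongrightarrow> sinh (2 * x) / (2 * x)"
    using LIMSEQ_subseq_LIMSEQ[OF sinh_product_formula[of "2 * x"], of "(*) 2"] assms
    by (simp add: strict_mono_def comp_def)
  then have "(\<lambda>n. ?P (2 * x) (2 * n) / ?P x n) \<longlonglongrightarrow> (sinh (2 * x) / (2 * x)) / (sinh x / x)"
    using assms by (intro tendsto_divide sinh_product_formula) auto
  also have "(sinh (2 * x) / (2 * x)) / (sinh x / x) = cosh x"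
    using assms by (simp add: sinh_double)
  finally show ?thesis
    unfolding eq .
qed

text \<open>With \<open>h = a / m\<close>, the logarithm of the power is
  \<open>a * (ln (g h) / h)\<close>, and \<open>ln (g h)\<close> has derivative \<open>D\<close> at
  0 because \<open>g 0 = 1\<close>.\<close>

lemma power_quotient_tendsto_exp:
  fixes g :: "real \<Rightarrow> real"
  assumes g: "(g has_real_derivative D) (at 0)" "g 0 = 1"
  shows "(\<lambda>m. g (a / real m) ^ m) \<longlonglongrightarrow> exp (a * D)"
proof (cases "a = 0")
  case False
  have a_lim: "(\<lambda>m. a / real m) \<longlonglongrightarrow> 0"
    by (rule lim_const_over_n)
  have "((\<lambda>h. ln (g h)) has_real_derivative D) (at 0)"
    using g by (auto intro!: derivative_eq_intros)
  then have "(\<lambda>h. ln (g h) / h) \<midarrow>0\<rightarrow> D"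
    using g by (simp add: has_field_derivative_iff)
  moreover have "filterlim (\<lambda>m. a / real m) (at 0) sequentially"
    using a_lim False unfolding filterlim_at
    by (auto intro: eventually_mono[OF eventually_gt_at_top[of 0]])
  ultimately have "(\<lambda>m. ln (g (a / real m)) / (a / real m)) \<longlonglongrightarrow> D"
    by (rule filterlim_compose)
  then have "(\<lambda>m. exp (a * (ln (g (a / real m)) / (a / real m)))) \<longlonglongrightarrow> exp (a * D)"
    by (intro tendsto_intros)
  \<comment> \<open>Only for large \<open>m\<close> is the base known to be positive, so that its
    logarithm represents it.\<close>
  moreover have "\<forall>\<^sub>F m in sequentially. exp (a * (ln (g (a / real m)) / (a / real m))) = g (a / real m) ^ m"
  proof -
    have "isCont g 0"
      using g(1) by (rule DERIV_isCont)
    then have "(\<lambda>m. g (a / real m)) \<longlonglongrightarrow> g 0"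
      using a_lim by (rule isCont_tendsto_compose)
    then have "\<forall>\<^sub>F m in sequentially. g (a / real m) > 0"
      using g(2) by (intro order_tendstoD(1)) auto
    then show ?thesis
      using eventually_gt_at_top[of 0]
    proof eventually_elim
      case (elim m)
      have "a * (ln (g (a / real m)) / (a / real m)) = real m * ln (g (a / real m))"
        using False elim by simp
      then show ?case
        using elim by (simp add: exp_of_nat_mult)
    qed
  qed
  ultimately show ?thesis
    by (rule Lim_transform_eventually)
qed (use g in simp)

section \<open>Multipliers obtained from the product formulas\<close>

text \<open>At the origin the quotients by \<open>sinh\<close> take the value 0 / 0 = 0 instead of
  their limits, so the convergence statements involving them hold only almost everywhere.\<close>

lemma AE_lborel_nonzero: "AE \<xi> in lborel. \<xi> \<noteq> (0::'a::euclidean_space)"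
  by (rule AE_lborel_singleton)

text \<open>Inverting the \<open>sinh\<close> product and raising it to the power \<open>p\<close>
  turns each factor into a resolvent power.\<close>

lemma fourier_multiplier_powr_sinh:
  fixes p \<tau> :: real
  assumes "p > 0" "\<tau> > 0"
  shows "fourier_multiplier (\<lambda>\<xi>::'a::euclidean_space. of_real ((\<tau> * norm \<xi> / sinh (\<tau> * norm \<xi>)) powr p))"
proof (rule fourier_multiplier_limit)
  show "fourier_multiplier (\<lambda>\<xi>::'a. \<Prod>k=1..n. of_real ((1 + (\<tau> / (pi * real k))\<^sup>2 * (norm \<xi>)\<^sup>2) powr - p))" for n
    using assms by (intro fourier_multiplier_prod fourier_multiplier_resolvent) auto
  have "(\<lambda>n. \<Prod>k=1..n. (1 + (\<tau> / (pi * real k))\<^sup>2 * (norm \<xi>)\<^sup>2) powr - p) \<longlonglongrightarrow>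
      (\<tau> * norm \<xi> / sinh (\<tau> * norm \<xi>)) powr p" if "\<xi> \<noteq> 0" for \<xi> :: 'a
  proof -
    let ?x = "\<tau> * norm \<xi>"
    have x: "?x > 0" using that assms by simp
    then have "sinh ?x / ?x > 0" by simp
    then have "(\<lambda>n. (\<Prod>k=1..n. 1 + (?x / (pi * real k))\<^sup>2) powr - p) \<longlonglongrightarrow> (sinh ?x / ?x) powr - p"
      using x by (intro tendsto_powr sinh_product_formula tendsto_const) auto
    also have "(sinh ?x / ?x) powr - p = (?x / sinh ?x) powr p"
      using x by (simp add: powr_minus powr_divide)
    also have "(\<lambda>n. (\<Prod>k=1..n. 1 + (?x / (pi * real k))\<^sup>2) powr - p) =
        (\<lambda>n. \<Prod>k=1..n. (1 + (\<tau> / (pi * real k))\<^sup>2 * (norm \<xi>)\<^sup>2) powr - p)"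
      by (simp add: prod_powr_distrib power_divide power_mult_distrib)
    finally show ?thesis .
  qed
  then show "AE \<xi>::'a in lborel. (\<lambda>n. \<Prod>k=1..n. complex_of_real ((1 + (\<tau> / (pi * real k))\<^sup>2 * (norm \<xi>)\<^sup>2) powr - p)) \<longlonglongrightarrow>
      of_real ((\<tau> * norm \<xi> / sinh (\<tau> * norm \<xi>)) powr p)"
    unfolding of_real_prod[symmetric] by (intro eventually_mono[OF AE_lborel_nonzero] tendsto_of_real)
qed measurable

text \<open>Dividing the two \<open>sinh\<close> products factor by factor leaves quotients whose
  denominators have the larger coefficients, because \<open>1 + h \<ge> 1\<close>.\<close>

lemma fourier_multiplier_sinh_ratio:
  fixes h \<tau> :: real
  assumes "h \<ge> 0" "\<tau> > 0"
  shows "fourier_multiplier (\<lambda>\<xi>::'a::euclidean_space.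
    of_real ((1 + h) * sinh (\<tau> * norm \<xi>) / sinh ((1 + h) * (\<tau> * norm \<xi>))))"
proof (rule fourier_multiplier_limit)
  show "fourier_multiplier (\<lambda>\<xi>::'a. \<Prod>k=1..n. of_real ((1 + (\<tau> / (pi * real k))\<^sup>2 * (norm \<xi>)\<^sup>2) /
      (1 + ((1 + h) * \<tau> / (pi * real k))\<^sup>2 * (norm \<xi>)\<^sup>2)))" for n
    using assms
    by (intro fourier_multiplier_prod fourier_multiplier_ratio power_mono divide_right_mono) auto
  have "(\<lambda>n. \<Prod>k=1..n. (1 + (\<tau> / (pi * real k))\<^sup>2 * (norm \<xi>)\<^sup>2) / (1 + ((1 + h) * \<tau> / (pi * real k))\<^sup>2 * (norm \<xi>)\<^sup>2)) \<longlonglongrightarrow>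
      (1 + h) * sinh (\<tau> * norm \<xi>) / sinh ((1 + h) * (\<tau> * norm \<xi>))" if "\<xi> \<noteq> 0" for \<xi> :: 'a
  proof -
    let ?x = "\<tau> * norm \<xi>"
    have x: "?x > 0" "(1 + h) * ?x > 0" using that assms by simp_all
    then have "(\<lambda>n. (\<Prod>k=1..n. 1 + (?x / (pi * real k))\<^sup>2) / (\<Prod>k=1..n. 1 + ((1 + h) * ?x / (pi * real k))\<^sup>2)) \<longlonglongrightarrow>
        (sinh ?x / ?x) / (sinh ((1 + h) * ?x) / ((1 + h) * ?x))"
      by (intro tendsto_divide sinh_product_formula) auto
    also have "(sinh ?x / ?x) / (sinh ((1 + h) * ?x) / ((1 + h) * ?x)) = (1 + h) * sinh ?x / sinh ((1 + h) * ?x)"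
      using x by simp
    finally show ?thesis
      by (simp add: prod_dividef power_divide power_mult_distrib mult.assoc)
  qed
  then show "AE \<xi>::'a in lborel. (\<lambda>n. \<Prod>k=1..n. complex_of_real ((1 + (\<tau> / (pi * real k))\<^sup>2 * (norm \<xi>)\<^sup>2) /
      (1 + ((1 + h) * \<tau> / (pi * real k))\<^sup>2 * (norm \<xi>)\<^sup>2))) \<longlonglongrightarrow>
      of_real ((1 + h) * sinh (\<tau> * norm \<xi>) / sinh ((1 + h) * (\<tau> * norm \<xi>)))"
    unfolding of_real_prod[symmetric] by (intro eventually_mono[OF AE_lborel_nonzero] tendsto_of_real)
qed measurable

lemma fourier_multiplier_cosh_ratio:
  fixes h \<tau> :: real
  assumes "h \<ge> 0" "\<tau> > 0"
  shows "fourier_multiplier (\<lambda>\<xi>::'a::euclidean_space.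
    of_real (cosh (\<tau> * norm \<xi>) / cosh ((1 + h) * (\<tau> * norm \<xi>))))"
proof (rule fourier_multiplier_limit)
  show "fourier_multiplier (\<lambda>\<xi>::'a. \<Prod>j<n. of_real ((1 + (2 * \<tau> / (pi * real (2 * j + 1)))\<^sup>2 * (norm \<xi>)\<^sup>2) /
      (1 + (2 * ((1 + h) * \<tau>) / (pi * real (2 * j + 1)))\<^sup>2 * (norm \<xi>)\<^sup>2)))" for n
    using assms
    by (intro fourier_multiplier_prod fourier_multiplier_ratio power_mono divide_right_mono) auto
  have "(\<lambda>n. \<Prod>j<n. (1 + (2 * \<tau> / (pi * real (2 * j + 1)))\<^sup>2 * (norm \<xi>)\<^sup>2) / (1 + (2 * ((1 + h) * \<tau>) / (pi * real (2 * j + 1)))\<^sup>2 * (norm \<xi>)\<^sup>2)) \<longlonglongrightarrow>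
      cosh (\<tau> * norm \<xi>) / cosh ((1 + h) * (\<tau> * norm \<xi>))" if "\<xi> \<noteq> 0" for \<xi> :: 'a
  proof -
    let ?x = "\<tau> * norm \<xi>"
    have x: "?x > 0" "(1 + h) * ?x > 0" using that assms by simp_all
    then have "(\<lambda>n. (\<Prod>j<n. 1 + (2 * ?x / (pi * real (2 * j + 1)))\<^sup>2) / (\<Prod>j<n. 1 + (2 * ((1 + h) * ?x) / (pi * real (2 * j + 1)))\<^sup>2)) \<longlonglongrightarrow>
        cosh ?x / cosh ((1 + h) * ?x)"
      by (intro tendsto_divide cosh_product_formula) auto
    then show ?thesis
      by (simp add: prod_dividef power_divide power_mult_distrib mult.assoc)
  qed
  then show "AE \<xi>::'a in lborel. (\<lambda>n. \<Prod>j<n. complex_of_real ((1 + (2 * \<tau> / (pi * real (2 * j + 1)))\<^sup>2 * (norm \<xi>)\<^sup>2) /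
      (1 + (2 * ((1 + h) * \<tau>) / (pi * real (2 * j + 1)))\<^sup>2 * (norm \<xi>)\<^sup>2))) \<longlonglongrightarrow>
      of_real (cosh (\<tau> * norm \<xi>) / cosh ((1 + h) * (\<tau> * norm \<xi>)))"
    unfolding of_real_prod[symmetric] by (intro eventually_mono[OF AE_lborel_nonzero] tendsto_of_real)
qed measurable

text \<open>Since \<open>x coth x\<close> and \<open>x tanh x\<close> are the derivatives of \<open>ln (sinh ((1 + h) x))\<close> and
  \<open>ln (cosh ((1 + h) x))\<close> at \<open>h = 0\<close>, the exponentials are limits of powers of the ratios above
  with \<open>h = a / m\<close>; this avoids the partial fraction expansion of \<open>coth\<close>.\<close>

lemma fourier_multiplier_exp_coth:
  fixes a \<tau> :: real
  assumes "a \<ge> 0" "\<tau> > 0"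
  shows "fourier_multiplier (\<lambda>\<xi>::'a::euclidean_space.
    of_real (exp (a * (1 - \<tau> * norm \<xi> * cosh (\<tau> * norm \<xi>) / sinh (\<tau> * norm \<xi>)))))"
proof (rule fourier_multiplier_limit)
  show "fourier_multiplier (\<lambda>\<xi>::'a.
      of_real ((1 + a / real m) * sinh (\<tau> * norm \<xi>) / sinh ((1 + a / real m) * (\<tau> * norm \<xi>))) ^ m)" for m
    using assms by (intro fourier_multiplier_power fourier_multiplier_sinh_ratio) auto
  have "(\<lambda>m. ((1 + a / real m) * sinh (\<tau> * norm \<xi>) / sinh ((1 + a / real m) * (\<tau> * norm \<xi>))) ^ m) \<longlonglongrightarrow>
      exp (a * (1 - \<tau> * norm \<xi> * cosh (\<tau> * norm \<xi>) / sinh (\<tau> * norm \<xi>)))" if "\<xi> \<noteq> 0" for \<xi> :: 'a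
  proof (rule power_quotient_tendsto_exp)
    have "sinh (\<tau> * norm \<xi>) \<noteq> 0"
      using that assms by simp
    then show "((\<lambda>h. (1 + h) * sinh (\<tau> * norm \<xi>) / sinh ((1 + h) * (\<tau> * norm \<xi>))) has_real_derivative
        1 - \<tau> * norm \<xi> * cosh (\<tau> * norm \<xi>) / sinh (\<tau> * norm \<xi>)) (at 0)"
      by (auto intro!: derivative_eq_intros simp: field_simps)
    show "(1 + 0) * sinh (\<tau> * norm \<xi>) / sinh ((1 + 0) * (\<tau> * norm \<xi>)) = 1"
      using that assms by simp
  qed
  then show "AE \<xi>::'a in lborel. (\<lambda>m. of_real ((1 + a / real m) * sinh (\<tau> * norm \<xi>) / sinh ((1 + a / real m) * (\<tau> * norm \<xi>))) ^ m) \<longlonglongrightarrow>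
      complex_of_real (exp (a * (1 - \<tau> * norm \<xi> * cosh (\<tau> * norm \<xi>) / sinh (\<tau> * norm \<xi>))))"
    unfolding of_real_power[symmetric] by (intro eventually_mono[OF AE_lborel_nonzero] tendsto_of_real)
qed measurable

lemma fourier_multiplier_exp_tanh:
  fixes b \<tau> :: real
  assumes "b \<ge> 0" "\<tau> > 0"
  shows "fourier_multiplier (\<lambda>\<xi>::'a::euclidean_space.
    of_real (exp (b * - (\<tau> * norm \<xi> * sinh (\<tau> * norm \<xi>) / cosh (\<tau> * norm \<xi>)))))"
proof (rule fourier_multiplier_limit)
  show "fourier_multiplier (\<lambda>\<xi>::'a.
      of_real (cosh (\<tau> * norm \<xi>) / cosh ((1 + b / real m) * (\<tau> * norm \<xi>))) ^ m)" for m
    using assms by (intro fourier_multiplier_power fourier_multiplier_cosh_ratio) auto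
  \<comment> \<open>The origin needs no exclusion here, as \<open>cosh\<close> has no zero.\<close>
  have "(\<lambda>m. (cosh (\<tau> * norm \<xi>) / cosh ((1 + b / real m) * (\<tau> * norm \<xi>))) ^ m) \<longlonglongrightarrow>
      exp (b * - (\<tau> * norm \<xi> * sinh (\<tau> * norm \<xi>) / cosh (\<tau> * norm \<xi>)))" for \<xi> :: 'a
  proof (rule power_quotient_tendsto_exp)
    show "((\<lambda>h. cosh (\<tau> * norm \<xi>) / cosh ((1 + h) * (\<tau> * norm \<xi>))) has_real_derivative
        - (\<tau> * norm \<xi> * sinh (\<tau> * norm \<xi>) / cosh (\<tau> * norm \<xi>))) (at 0)"
      by (auto intro!: derivative_eq_intros simp: field_simps)
  qed simp
  then show "AE \<xi>::'a in lborel. (\<lambda>m. of_real (cosh (\<tau> * norm \<xi>) / cosh ((1 + b / real m) * (\<tau> * norm \<xi>))) ^ m) \<longlonglongrightarrow>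
      complex_of_real (exp (b * - (\<tau> * norm \<xi> * sinh (\<tau> * norm \<xi>) / cosh (\<tau> * norm \<xi>))))"
    unfolding of_real_power[symmetric] by (intro AE_I2 tendsto_of_real)
qed measurable

subsection \<open>Gaussian regularisation and integrability\<close>

text \<open>Lebesgue measure is the image of the product of the coordinate measures, so Fubini
  factorises the integral.\<close>

lemma
  fixes f :: "'a::euclidean_space \<Rightarrow> real \<Rightarrow> 'b::{real_normed_field,banach,second_countable_topology}"
  assumes f: "\<And>b. b \<in> Basis \<Longrightarrow> integrable lborel (f b)"
  shows integrable_lborel_prod: "integrable lborel (\<lambda>x. \<Prod>b\<in>Basis. f b (x \<bullet> b))" (is ?I)
    and integral_lborel_prod: "(\<integral>x. (\<Prod>b\<in>Basis. f b (x \<bullet> b)) \<partial>lborel) = (\<Prod>b\<in>Basis. \<integral>x. f b x \<partial>lborel)" (is ?E)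
proof -
  interpret product_sigma_finite "\<lambda>_::'a. lborel :: real measure" ..
  have [measurable]: "f b \<in> borel_measurable borel" if "b \<in> Basis" for b
    using f[OF that] by auto
  have *: "(\<Prod>b\<in>Basis. f b ((\<Sum>b\<in>Basis. g b *\<^sub>R b) \<bullet> b)) = (\<Prod>b\<in>Basis. f b (g b))" for g
    by (intro prod.cong) auto
  show ?I
    by (subst lborel_eq) (simp add: integrable_distr_eq * product_integrable_prod f)
  show ?E
    by (subst lborel_eq) (simp add: integral_distr * product_integral_prod f)
qed

lemma gaussian_eq_normal_density:
  assumes "\<sigma> > 0"
  shows "exp (- ((\<sigma> * x)\<^sup>2 / 2)) = sqrt (2 * pi) / \<sigma> * normal_density 0 (1 / \<sigma>) x"
  using assms by (simp add: normal_density_def real_sqrt_mult real_sqrt_divide power_mult_distrib field_simps)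

text \<open>The characteristic function of the standard normal law after the substitution of
  \<open>\<sigma> * x\<close> for \<open>x\<close>. In the form of a normal density, the result
  visibly has integral \<open>2 * pi\<close>.\<close>

lemma integral_gaussian_iexp:
  assumes "\<sigma> > 0"
  shows "(\<integral>x. of_real (exp (- ((\<sigma> * x)\<^sup>2 / 2))) * iexp (x * y) \<partial>lborel) = of_real (2 * pi * normal_density 0 \<sigma> y)"
proof -
  have "(\<integral>x. iexp (y / \<sigma> * x) \<partial>std_normal_distribution) = of_real (exp (- (y / \<sigma>)\<^sup>2 / 2))"
    using fun_cong[OF char_std_normal_distribution, of "y / \<sigma>"] by (simp add: char_def)
  then have "(\<integral>x. std_normal_density x *\<^sub>R iexp (y / \<sigma> * x) \<partial>lborel) = of_real (exp (- (y / \<sigma>)\<^sup>2 / 2))"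
    by (subst (asm) integral_density) auto
  also have "(\<integral>x. std_normal_density x *\<^sub>R iexp (y / \<sigma> * x) \<partial>lborel) =
      \<bar>\<sigma>\<bar> *\<^sub>R (\<integral>x. std_normal_density (0 + \<sigma> * x) *\<^sub>R iexp (y / \<sigma> * (0 + \<sigma> * x)) \<partial>lborel)"
    using assms by (intro lborel_integral_real_affine) auto
  also have "(\<integral>x. std_normal_density (0 + \<sigma> * x) *\<^sub>R iexp (y / \<sigma> * (0 + \<sigma> * x)) \<partial>lborel) =
      (\<integral>x. of_real (1 / sqrt (2 * pi)) * (of_real (exp (- ((\<sigma> * x)\<^sup>2 / 2))) * iexp (x * y)) \<partial>lborel)"
    using assms
    by (intro Bochner_Integration.integral_cong) (auto simp: std_normal_density_def scaleR_conv_of_real mult.commute)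
  also have "\<dots> = of_real (1 / sqrt (2 * pi)) * (\<integral>x. of_real (exp (- ((\<sigma> * x)\<^sup>2 / 2))) * iexp (x * y) \<partial>lborel)"
    by (rule integral_mult_right_zero)
  finally have "(\<integral>x. of_real (exp (- ((\<sigma> * x)\<^sup>2 / 2))) * iexp (x * y) \<partial>lborel) =
      complex_of_real (sqrt (2 * pi) / \<sigma> * exp (- (y / \<sigma>)\<^sup>2 / 2))"
    using assms by (simp add: scaleR_conv_of_real field_simps)
  also have "sqrt (2 * pi) / \<sigma> * exp (- (y / \<sigma>)\<^sup>2 / 2) = 2 * pi * normal_density 0 \<sigma> y"
    using assms by (simp add: normal_density_def real_sqrt_mult field_simps)
  finally show ?thesis .
qed

lemma exp_norm_power2_eq_prod:
  fixes \<xi> :: "'a::euclidean_space"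
  shows "exp (- (c * (norm \<xi>)\<^sup>2)) = (\<Prod>b\<in>Basis. exp (- (c * (\<xi> \<bullet> b)\<^sup>2)))"
  unfolding power2_norm_eq_inner euclidean_inner[of \<xi> \<xi>] sum_distrib_left
  by (simp add: power2_eq_square flip: sum_negf exp_sum)

text \<open>The transform is a product over the coordinates of \<open>2 * pi\<close> times normal
  densities. Its L^1 norm therefore does not depend on \<open>\<sigma>\<close>, which permits the
  limit \<open>\<sigma>\<close> to 0.\<close>

lemma fourier_L1_le_gaussian:
  assumes "\<sigma> > 0"
  shows "fourier_L1_le ((2 * pi) ^ DIM('a)) (\<lambda>\<xi>::'a::euclidean_space. of_real (exp (- (\<sigma>\<^sup>2 / 2 * (norm \<xi>)\<^sup>2))))"
proof -
  let ?g = "\<lambda>x::real. complex_of_real (exp (- ((\<sigma> * x)\<^sup>2 / 2)))"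
  have int_g: "integrable lborel ?g"
    unfolding gaussian_eq_normal_density[OF assms]
    using assms by (intro integrable_of_real integrable_mult_right integrable_normal_density) simp
  then have int_gi: "integrable lborel (\<lambda>x. ?g x * iexp (x * c))" for c
    by (rule Bochner_Integration.integrable_bound) (auto simp: norm_mult)
  have prod: "complex_of_real (exp (- (\<sigma>\<^sup>2 / 2 * (norm \<xi>)\<^sup>2))) = (\<Prod>b\<in>Basis. ?g (\<xi> \<bullet> b))" for \<xi> :: 'a
    by (subst exp_norm_power2_eq_prod) (simp add: power_mult_distrib)
  have "integrable lborel (\<lambda>\<xi>::'a. \<Prod>b\<in>Basis. ?g (\<xi> \<bullet> b))"
    by (rule integrable_lborel_prod[OF int_g])
  moreover have "fourier_integral (\<lambda>\<xi>. \<Prod>b\<in>Basis. ?g (\<xi> \<bullet> b)) y = (\<Prod>b\<in>Basis. of_real (2 * pi * normal_density 0 \<sigma> (y \<bullet> b)))"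
    for y :: 'a
  proof -
    have "iexp (\<xi> \<bullet> y) = (\<Prod>b\<in>Basis. iexp ((\<xi> \<bullet> b) * (y \<bullet> b)))" for \<xi> :: 'a
      by (simp add: euclidean_inner[of \<xi> y] sum_distrib_left flip: exp_sum)
    then have "fourier_integral (\<lambda>\<xi>. \<Prod>b\<in>Basis. ?g (\<xi> \<bullet> b)) y =
        (\<integral>\<xi>. (\<Prod>b\<in>Basis. ?g (\<xi> \<bullet> b) * iexp ((\<xi> \<bullet> b) * (y \<bullet> b))) \<partial>lborel)"
      by (simp add: fourier_integral_def prod.distrib)
    also have "\<dots> = (\<Prod>b\<in>Basis. \<integral>x. ?g x * iexp (x * (y \<bullet> b)) \<partial>lborel)"
      by (rule integral_lborel_prod[OF int_gi])
    finally show ?thesis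
      using integral_gaussian_iexp[OF assms] by simp
  qed
  moreover have "(\<integral>\<^sup>+y. norm (\<Prod>b\<in>Basis. complex_of_real (2 * pi * normal_density 0 \<sigma> (y \<bullet> b))) \<partial>(lborel::'a measure)) =
      (2 * pi) ^ DIM('a)"
  proof -
    have "(\<integral>\<^sup>+y. norm (\<Prod>b\<in>Basis. complex_of_real (2 * pi * normal_density 0 \<sigma> (y \<bullet> b))) \<partial>(lborel::'a measure)) =
        (\<integral>\<^sup>+y. (\<Prod>b\<in>Basis. ennreal (2 * pi * normal_density 0 \<sigma> (y \<bullet> b))) \<partial>(lborel::'a measure))"
      by (intro nn_integral_cong) (simp add: prod_norm[symmetric] norm_mult prod_ennreal)
    also have "\<dots> = (\<Prod>b\<in>(Basis::'a set). \<integral>\<^sup>+x. ennreal (2 * pi * normal_density 0 \<sigma> x) \<partial>lborel)"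
      by (intro nn_integral_lborel_prod) auto
    also have "(\<integral>\<^sup>+x. ennreal (2 * pi * normal_density 0 \<sigma> x) \<partial>lborel) = ennreal (2 * pi)"
      using assms by (subst nn_integral_eq_integral) auto
    finally show ?thesis
      by (simp add: ennreal_power)
  qed
  ultimately show ?thesis
    unfolding fourier_L1_le_def prod by (simp only: order_refl simp_thms)
qed

text \<open>Multiplying \<open>g\<close> by ever wider Gaussians gives functions that satisfy the
  Gaussian bound, are dominated by \<open>norm (g \<xi>)\<close> and converge to
  \<open>g\<close>.\<close>

lemma fourier_L1_le_multiplier:
  fixes g :: "'a::euclidean_space \<Rightarrow> complex"
  assumes g: "fourier_multiplier g" "integrable lborel g"
  shows "fourier_L1_le ((2 * pi) ^ DIM('a)) g"
proof (rule fourier_L1_le_limit)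
  let ?\<sigma> = "\<lambda>n. 1 / real (Suc n)"
  let ?e = "\<lambda>n (\<xi>::'a). complex_of_real (exp (- ((?\<sigma> n)\<^sup>2 / 2 * (norm \<xi>)\<^sup>2)))"
  show "fourier_L1_le ((2 * pi) ^ DIM('a)) (\<lambda>\<xi>. g \<xi> * ?e n \<xi>)" for n
    by (intro fourier_multiplierD(3)[OF g(1)] fourier_L1_le_gaussian) simp
  show "integrable lborel (\<lambda>\<xi>. norm (g \<xi>))"
    using g(2) by simp
  show "AE \<xi> in lborel. norm (g \<xi> * ?e n \<xi>) \<le> norm (g \<xi>)" for n
    by (intro AE_I2) (auto simp: norm_mult intro!: mult_right_le_one_le)
  have "(\<lambda>n. g \<xi> * ?e n \<xi>) \<longlonglongrightarrow> g \<xi> * of_real (exp (- (0\<^sup>2 / 2 * (norm \<xi>)\<^sup>2)))" for \<xi>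
    by (intro tendsto_intros LIMSEQ_Suc[OF lim_const_over_n]) simp
  then show "AE \<xi> in lborel. (\<lambda>n. g \<xi> * ?e n \<xi>) \<longlonglongrightarrow> g \<xi>"
    by simp
  show "g \<in> borel_measurable borel"
    using g(2) by auto
qed

section \<open>Integrability of the envelope by exponential decay\<close>

lemma divide_sinh_le:
  fixes r :: real
  assumes "r \<ge> 0"
  shows "r / sinh r \<le> 4 * exp (- (r / 2))"
proof (cases "r = 0")
  case False
  then have r: "r > 0" using assms by simp
  \<comment> \<open>A rearrangement of \<open>1 + 2 * r \<le> exp (2 * r)\<close>; it keeps a factor
    \<open>r\<close> in the lower bound for \<open>sinh r\<close>, which cancels the
    numerator.\<close>
  have "2 * r / (1 + 2 * r) \<le> 1 - exp (- 2 * r)"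
    using exp_ge_add_one_self[of "2 * r"] r by (simp add: exp_minus field_simps)
  then have "exp r / 2 * (2 * r / (1 + 2 * r)) \<le> exp r / 2 * (1 - exp (- 2 * r))"
    by (intro mult_left_mono) auto
  also have "\<dots> = sinh r"
    by (simp add: sinh_field_def algebra_simps flip: exp_add)
  finally have "r / sinh r \<le> r / (exp r / 2 * (2 * r / (1 + 2 * r)))"
    using r by (intro divide_left_mono mult_pos_pos) auto
  also have "\<dots> = (1 + 2 * r) * exp (- r)"
    using r by (simp add: exp_minus field_simps)
  \<comment> \<open>Half of the decay absorbs the linear factor:
    \<open>1 + 2 * r \<le> 4 * (1 + r / 2)\<close>.\<close>
  also have "\<dots> \<le> 4 * exp (r / 2) * exp (- r)"
    using exp_ge_add_one_self[of "r / 2"] by (intro mult_right_mono) (linarith, simp)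
  also have "\<dots> = 4 * exp (- (r / 2))"
    by (simp flip: exp_add)
  finally show ?thesis .
qed simp

lemma integrable_exp_abs:
  fixes c :: real
  assumes "c > 0"
  shows "integrable lborel (\<lambda>x::real. exp (- (c * \<bar>x\<bar>)))"
proof (rule Bochner_Integration.integrable_bound)
  have "integrable lborel (\<lambda>x::real. inverse (1 + x\<^sup>2))"
    using integrable_inverse_1_plus_square by (simp add: set_integrable_def)
  then show "integrable lborel (\<lambda>x::real. max 1 (2 / c\<^sup>2) * inverse (1 + x\<^sup>2))"
    by (rule integrable_mult_right)
  have "exp (- (c * \<bar>x\<bar>)) \<le> max 1 (2 / c\<^sup>2) * inverse (1 + x\<^sup>2)" for x
  proof -
    \<comment> \<open>Chosen so that \<open>D\<close> times the quadratic Taylor polynomial of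
      \<open>exp (c * \<bar>x\<bar>)\<close> dominates both terms of
      \<open>1 + x\<^sup>2\<close>.\<close>
    define D where "D = max 1 (2 / c\<^sup>2)"
    have D: "D \<ge> 1" "D * (c\<^sup>2 / 2) \<ge> 1"
      using assms by (auto simp: D_def field_simps max_def)
    have "1 + x\<^sup>2 \<le> D * 1 + D * (c\<^sup>2 / 2) * x\<^sup>2"
      using D(1) mult_right_mono[OF D(2), of "x\<^sup>2"] by simp
    also have "\<dots> \<le> D * (1 + c * \<bar>x\<bar> + (c * \<bar>x\<bar>)\<^sup>2 / 2)"
      using D assms by (simp add: ring_distribs power_mult_distrib)
    also have "\<dots> \<le> D * exp (c * \<bar>x\<bar>)"
      using D assms by (intro mult_left_mono exp_lower_Taylor_quadratic) auto
    finally have "1 + x\<^sup>2 \<le> D * exp (c * \<bar>x\<bar>)" .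
    moreover have "1 + x\<^sup>2 > 0"
      by (intro add_pos_nonneg) auto
    ultimately show ?thesis
      unfolding D_def[symmetric] by (simp add: exp_minus field_simps)
  qed
  then show "AE x in lborel. norm (exp (- (c * \<bar>x\<bar>))) \<le> norm (max 1 (2 / c\<^sup>2) * inverse (1 + x\<^sup>2))"
    by (intro AE_I2) (auto simp: abs_mult intro: order_trans)
qed measurable

text \<open>Each coordinate is at most the norm, so giving every coordinate the share
  \<open>c / DIM('a)\<close> of the rate bounds the radial function by a product.\<close>

lemma integrable_exp_norm:
  fixes c :: real
  assumes "c > 0"
  shows "integrable lborel (\<lambda>\<xi>::'a::euclidean_space. exp (- (c * norm \<xi>)))"
proof (rule Bochner_Integration.integrable_bound)
  let ?d = "c / real DIM('a)"
  show "integrable lborel (\<lambda>\<xi>::'a. \<Prod>b\<in>Basis. exp (- (?d * \<bar>\<xi> \<bullet> b\<bar>)))"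
    using assms by (intro integrable_lborel_prod integrable_exp_abs) simp
  have "exp (- (c * norm \<xi>)) \<le> (\<Prod>b\<in>Basis. exp (- (?d * \<bar>\<xi> \<bullet> b\<bar>)))" for \<xi> :: 'a
  proof -
    have "(\<Sum>b\<in>Basis. ?d * \<bar>\<xi> \<bullet> b\<bar>) \<le> (\<Sum>b\<in>(Basis::'a set). ?d * norm \<xi>)"
      using assms by (intro sum_mono mult_left_mono) (auto intro: Basis_le_norm)
    then show ?thesis
      by (simp add: sum_negf flip: exp_sum)
  qed
  then show "AE \<xi>::'a in lborel. norm (exp (- (c * norm \<xi>))) \<le> norm (\<Prod>b\<in>Basis. exp (- (?d * \<bar>\<xi> \<bullet> b\<bar>)))"
    by (intro AE_I2) (simp add: abs_prod)
qed measurable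

lemma integrable_divide_sinh_powr:
  fixes p \<tau> :: real
  assumes "p > 0" "\<tau> > 0"
  shows "integrable lborel (\<lambda>\<xi>::'a::euclidean_space. (\<tau> * norm \<xi> / sinh (\<tau> * norm \<xi>)) powr p)"
proof (rule Bochner_Integration.integrable_bound)
  show "integrable lborel (\<lambda>\<xi>::'a. 4 powr p * exp (- (p * \<tau> / 2 * norm \<xi>)))"
    using assms by (intro integrable_mult_right integrable_exp_norm) simp
  have "(\<tau> * norm \<xi> / sinh (\<tau> * norm \<xi>)) powr p \<le> 4 powr p * exp (- (p * \<tau> / 2 * norm \<xi>))" for \<xi> :: 'a
  proof -
    have "(\<tau> * norm \<xi> / sinh (\<tau> * norm \<xi>)) powr p \<le> (4 * exp (- (\<tau> * norm \<xi> / 2))) powr p"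
      using assms by (intro powr_mono2 divide_sinh_le) (auto intro!: divide_nonneg_nonneg)
    also have "\<dots> = 4 powr p * exp (- (p * \<tau> / 2 * norm \<xi>))"
      by (simp add: powr_mult exp_powr_real mult_ac)
    finally show ?thesis .
  qed
  then show "AE \<xi>::'a in lborel. norm ((\<tau> * norm \<xi> / sinh (\<tau> * norm \<xi>)) powr p) \<le> norm (4 powr p * exp (- (p * \<tau> / 2 * norm \<xi>)))"
    by (intro AE_I2) (simp add: abs_mult)
qed measurable

lemma integral_lborel_scaleR:
  fixes f :: "'a::euclidean_space \<Rightarrow> real"
  assumes [measurable]: "f \<in> borel_measurable borel" and "c > 0"
  shows "(\<integral>x. f (c *\<^sub>R x) \<partial>lborel) = (\<integral>x. f x \<partial>lborel) / c ^ DIM('a)"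
proof -
  have "(\<integral>x. f x \<partial>lborel) = (\<integral>x. f x \<partial>density (distr lborel borel (\<lambda>x. 0 + c *\<^sub>R x)) (\<lambda>_. ennreal (\<bar>c\<bar> ^ DIM('a))))"
    using lborel_affine[of c "0 :: 'a"] assms by simp
  also have "\<dots> = c ^ DIM('a) * (\<integral>x. f (c *\<^sub>R x) \<partial>lborel)"
    using assms by (subst integral_density) (auto simp: integral_distr)
  finally show ?thesis
    using assms by simp
qed

section \<open>Interpolation between L^1 and the supremum\<close>

text \<open>For finite exponent \<open>p\<close>, integrate
  \<open>norm (f z) powr p \<le> S powr (p - 1) * norm (f z)\<close> and take the root. For
  \<open>q = \<infinity>\<close> the reciprocal is 0 and only \<open>S\<close> survives.\<close>

lemma Lq_norm_interpolation:
  fixes f :: "'a \<Rightarrow> 'b::{real_normed_vector, second_countable_topology}"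
  assumes q: "1 \<le> q" and f[measurable]: "f \<in> borel_measurable M"
    and S: "\<And>z. norm (f z) \<le> S" "S > 0"
    and A: "(\<integral>\<^sup>+z. norm (f z) \<partial>M) \<le> ennreal A" "A > 0"
  shows "Lq_norm q M f \<le> ennreal (S powr (1 - enn2real (1 / q)) * A powr (enn2real (1 / q)))"
proof (cases "q = \<infinity>")
  case True
  have "esssup M (\<lambda>z. ennreal (norm (f z))) \<le> ennreal S"
    using S by (intro esssup_I AE_I2 ennreal_leI) auto
  then show ?thesis
    using S A True by (simp add: Lq_norm_def)
next
  case False
  define p where "p = enn2real q"
  have q_eq: "q = ennreal p"
    using False by (simp add: p_def less_top)
  have p: "p \<ge> 1"
    using q unfolding q_eq by simp
  have inv: "enn2real (1 / q) = 1 / p"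
    using p unfolding q_eq by (simp add: divide_ennreal flip: ennreal_1)
  have "norm (f z) powr p \<le> S powr (p - 1) * norm (f z)" for z
  proof (cases "f z = 0")
    case False
    have "norm (f z) powr p = norm (f z) powr (p - 1) * norm (f z)"
      using False by (simp add: powr_diff)
    also have "\<dots> \<le> S powr (p - 1) * norm (f z)"
      using S p by (intro mult_right_mono powr_mono2) auto
    finally show ?thesis .
  qed simp
  then have "(\<integral>\<^sup>+z. ennreal (norm (f z) powr p) \<partial>M) \<le> (\<integral>\<^sup>+z. ennreal (S powr (p - 1)) * ennreal (norm (f z)) \<partial>M)"
    by (intro nn_integral_mono) (simp flip: ennreal_mult)
  also have "\<dots> = ennreal (S powr (p - 1)) * (\<integral>\<^sup>+z. ennreal (norm (f z)) \<partial>M)"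
    by (rule nn_integral_cmult) measurable
  also have "\<dots> \<le> ennreal (S powr (p - 1)) * ennreal A"
    using A by (intro mult_left_mono) auto
  also have "\<dots> = ennreal (S powr (p - 1) * A)"
    using A by (simp add: ennreal_mult)
  finally have I: "(\<integral>\<^sup>+z. ennreal (norm (f z) powr p) \<partial>M) \<le> ennreal (S powr (p - 1) * A)" (is "?I \<le> _") .
  \<comment> \<open>This rules out the infinite branch of \<open>Lq_norm\<close>.\<close>
  then have fin: "?I < \<infinity>"
    by (rule le_less_trans) simp
  have "enn2real ?I powr (1 / p) \<le> (S powr (p - 1) * A) powr (1 / p)"
    using I p S A by (intro powr_mono2 enn2real_leI) auto
  also have "\<dots> = S powr (1 - 1 / p) * A powr (1 / p)"
    using S A p by (simp add: powr_mult powr_powr diff_divide_distrib)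
  finally show ?thesis
    using fin False unfolding inv by (auto simp: Lq_norm_def Let_def p_def[symmetric] intro: ennreal_leI)
qed

subsection \<open>The heat kernel\<close>

text \<open>With \<open>s = t / 2 * r\<close>, \<open>coth (2 * s)\<close> and
  \<open>csch (2 * s)\<close> are half the sum and half the difference of coth s and tanh s.
  Collecting the two functions completes the squares of \<open>x - x0\<close> and
  \<open>x + x0\<close>.\<close>

lemma mehler_exponent:
  fixes x x0 :: "'a::euclidean_space" and t r :: real
  assumes "t > 0" "r > 0"
  shows "r / 2 * (((norm x)\<^sup>2 + (norm x0)\<^sup>2) * coth (r * t) - 2 * (x \<bullet> x0) * csch (r * t)) =
    (norm (x - x0))\<^sup>2 / (2 * t) * (t / 2 * r * cosh (t / 2 * r) / sinh (t / 2 * r)) +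
    (norm (x + x0))\<^sup>2 / (2 * t) * (t / 2 * r * sinh (t / 2 * r) / cosh (t / 2 * r))"
proof -
  define c s where "c = cosh (t / 2 * r)" and "s = sinh (t / 2 * r)"
  have "t / 2 * r > 0" using assms by simp
  then have pos: "s > 0" "c > 0" by (auto simp: c_def s_def)
  have rt: "r * t = 2 * (t / 2 * r)" by simp
  have cs: "c\<^sup>2 - s\<^sup>2 = 1"
    by (simp add: c_def s_def cosh_square_eq)
  have coth: "coth (r * t) = (c\<^sup>2 + s\<^sup>2) / (2 * s * c)"
    unfolding coth_def rt cosh_double sinh_double by (simp add: c_def s_def)
  \<comment> \<open>The numerator 1 is written as \<open>c\<^sup>2 - s\<^sup>2\<close> to match the
    numerator of \<open>coth\<close>, so that the final identity is purely algebraic.\<close>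
  have csch: "csch (r * t) = (c\<^sup>2 - s\<^sup>2) / (2 * s * c)"
    unfolding csch_def rt sinh_double cs by (simp add: c_def s_def)
  have nm: "(norm (x - x0))\<^sup>2 = (norm x)\<^sup>2 + (norm x0)\<^sup>2 - 2 * (x \<bullet> x0)"
    "(norm (x + x0))\<^sup>2 = (norm x)\<^sup>2 + (norm x0)\<^sup>2 + 2 * (x \<bullet> x0)"
    by (simp_all add: power2_norm_eq_inner inner_diff inner_add inner_commute)
  show ?thesis
    unfolding coth csch nm c_def[symmetric] s_def[symmetric]
    using pos assms by (simp add: divide_simps) (simp add: algebra_simps power2_eq_square)
qed

text \<open>The \<open>1\<close> in the first exponent normalises the value in the limit \<open>\<xi> \<rightarrow> 0\<close> to \<open>1\<close>, as is
  needed for a multiplier; it is compensated by the Gaussian factor in \<open>grushin_heat_kernel_eq\<close>.\<close>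

definition grushin_phase :: "real ^ 'n \<Rightarrow> real ^ 'n \<Rightarrow> real \<Rightarrow> real ^ 'k \<Rightarrow> real" where
  "grushin_phase x x0 t \<xi> =
    exp ((norm (x - x0))\<^sup>2 / (2 * t) * (1 - t / 2 * norm \<xi> * cosh (t / 2 * norm \<xi>) / sinh (t / 2 * norm \<xi>))) *
    exp ((norm (x + x0))\<^sup>2 / (2 * t) * - (t / 2 * norm \<xi> * sinh (t / 2 * norm \<xi>) / cosh (t / 2 * norm \<xi>)))"

definition grushin_symbol :: "real ^ 'n \<Rightarrow> real ^ 'n \<Rightarrow> real \<Rightarrow> real ^ 'k \<Rightarrow> complex" where
  "grushin_symbol x x0 t \<xi> =
    of_real ((t * norm \<xi> / sinh (t * norm \<xi>)) powr (real CARD('n) / 2)) * of_real (grushin_phase x x0 t \<xi>)"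

definition grushin_const :: "'n::finite itself \<Rightarrow> 'k::finite itself \<Rightarrow> real" where
  "grushin_const _ _ = 1 / (2 * pi) powr ((real CARD('n) + 2 * real CARD('k)) / 2)"

lemma grushin_heat_kernel_eq:
  fixes x x0 :: "real ^ 'n" and y :: "real ^ 'k"
  assumes t: "t > 0"
  shows "grushin_heat_kernel x x0 y t =
    of_real (grushin_const TYPE('n) TYPE('k) * t powr - (real CARD('n) / 2) * exp (- ((norm (x - x0))\<^sup>2 / (2 * t)))) *
    fourier_integral (grushin_symbol x x0 t) y"
proof -
  let ?p = "real CARD('n) / 2"
  let ?a = "(norm (x - x0))\<^sup>2 / (2 * t)"
  have "complex_of_real ((norm \<xi> / sinh (norm \<xi> * t)) powr ?p) *
          exp (\<i> * complex_of_real (\<xi> \<bullet> y) - complex_of_real (norm \<xi> / 2 *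
            (((norm x)\<^sup>2 + (norm x0)\<^sup>2) * coth (norm \<xi> * t) - 2 * (x \<bullet> x0) * csch (norm \<xi> * t)))) =
        of_real (t powr - ?p * exp (- ?a)) * (grushin_symbol x x0 t \<xi> * iexp (\<xi> \<bullet> y))" for \<xi> :: "real ^ 'k"
  \<comment> \<open>At the origin both integrands vanish, since 0 / 0 = 0 and a power of 0 is 0; the
    identity thus holds everywhere.\<close>
  proof (cases "\<xi> = 0")
    case False
    then have r: "norm \<xi> > 0" by simp
    have "norm \<xi> / sinh (norm \<xi> * t) = (1 / t) * (t * norm \<xi> / sinh (t * norm \<xi>))"
      using t by (simp add: mult.commute)
    then have 1: "(norm \<xi> / sinh (norm \<xi> * t)) powr ?p = t powr - ?p * (t * norm \<xi> / sinh (t * norm \<xi>)) powr ?p"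
      using t r by (simp only: powr_mult) (simp add: powr_divide powr_minus_divide)
    have 2: "exp (- (norm \<xi> / 2 * (((norm x)\<^sup>2 + (norm x0)\<^sup>2) * coth (norm \<xi> * t) - 2 * (x \<bullet> x0) * csch (norm \<xi> * t)))) =
        exp (- ?a) * grushin_phase x x0 t \<xi>"
      unfolding mehler_exponent[OF t r] grushin_phase_def exp_add[symmetric]
      by (simp add: algebra_simps)
    have 3: "exp (\<i> * complex_of_real (\<xi> \<bullet> y) - complex_of_real E) = iexp (\<xi> \<bullet> y) * of_real (exp (- E))" for E
      by (simp add: exp_diff exp_minus divide_inverse exp_of_real)
    show ?thesis
      unfolding 1 3 2 grushin_symbol_def by (simp only: of_real_mult mult_ac)
  qed (simp add: grushin_symbol_def)
  then show ?thesis
    unfolding grushin_heat_kernel_def fourier_integral_def grushin_const_def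
    by (simp only: integral_mult_right_zero of_real_mult mult.assoc)
qed

lemma grushin_phase_multiplier:
  fixes x x0 :: "real ^ 'n"
  assumes t: "t > 0"
  shows "fourier_multiplier (\<lambda>\<xi>::real ^ 'k. of_real (grushin_phase x x0 t \<xi>))"
  unfolding grushin_phase_def of_real_mult
  using t by (intro fourier_multiplier_mult fourier_multiplier_exp_coth fourier_multiplier_exp_tanh) auto

lemma grushin_symbol_multiplier:
  fixes x x0 :: "real ^ 'n"
  assumes t: "t > 0"
  shows "fourier_multiplier (grushin_symbol x x0 t :: real ^ 'k \<Rightarrow> complex)"
  unfolding grushin_symbol_def[abs_def]
  using t by (intro fourier_multiplier_mult fourier_multiplier_powr_sinh grushin_phase_multiplier) auto

text \<open>Being a multiplier already bounds the phase by 1, which leaves an envelope independent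
  of \<open>x\<close> and \<open>x0\<close>.\<close>

lemma norm_grushin_symbol_le:
  fixes x x0 :: "real ^ 'n"
  assumes t: "t > 0"
  shows "AE \<xi>::real ^ 'k in lborel. norm (grushin_symbol x x0 t \<xi>) \<le> (t * norm \<xi> / sinh (t * norm \<xi>)) powr (real CARD('n) / 2)"
  using fourier_multiplierD(2)[OF grushin_phase_multiplier[OF t, of x x0]]
  by eventually_elim (simp add: grushin_symbol_def norm_mult mult_right_le_one_le)

lemma integrable_grushin_symbol:
  fixes x x0 :: "real ^ 'n"
  assumes t: "t > 0"
  shows "integrable lborel (grushin_symbol x x0 t :: real ^ 'k \<Rightarrow> complex)"
proof (rule Bochner_Integration.integrable_bound)
  show "integrable lborel (\<lambda>\<xi>::real ^ 'k. (t * norm \<xi> / sinh (t * norm \<xi>)) powr (real CARD('n) / 2))"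
    using t by (intro integrable_divide_sinh_powr) auto
  show "AE \<xi>::real ^ 'k in lborel. norm (grushin_symbol x x0 t \<xi>) \<le>
      norm ((t * norm \<xi> / sinh (t * norm \<xi>)) powr (real CARD('n) / 2))"
    using norm_grushin_symbol_le[OF t] by simp
  show "(grushin_symbol x x0 t :: real ^ 'k \<Rightarrow> complex) \<in> borel_measurable lborel"
    using fourier_multiplierD(1)[OF grushin_symbol_multiplier[OF t]] by simp
qed

definition grushin_weight :: "'n::finite itself \<Rightarrow> 'k::finite itself \<Rightarrow> real" where
  "grushin_weight _ _ = (\<integral>(\<xi>::real ^ 'k). (norm \<xi> / sinh (norm \<xi>)) powr (real CARD('n) / 2) \<partial>lborel)"

text \<open>The character has modulus 1, and scaling \<open>\<xi>\<close> by \<open>t\<close> in the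
  envelope contributes the Jacobian \<open>t ^ CARD('k)\<close>.\<close>

lemma norm_fourier_grushin_symbol_le:
  fixes x x0 :: "real ^ 'n" and y :: "real ^ 'k"
  assumes t: "t > 0"
  shows "norm (fourier_integral (grushin_symbol x x0 t) y) \<le> grushin_weight TYPE('n) TYPE('k) / t ^ CARD('k)"
proof -
  let ?w = "\<lambda>\<xi>::real ^ 'k. (norm \<xi> / sinh (norm \<xi>)) powr (real CARD('n) / 2)"
  have eq: "?w (t *\<^sub>R \<xi>) = (t * norm \<xi> / sinh (t * norm \<xi>)) powr (real CARD('n) / 2)" for \<xi>
    using t by simp
  have int: "integrable lborel (\<lambda>\<xi>. ?w (t *\<^sub>R \<xi>))"
    unfolding eq using t by (intro integrable_divide_sinh_powr) auto
  have "norm (fourier_integral (grushin_symbol x x0 t) y) \<le> (\<integral>\<xi>. norm (grushin_symbol x x0 t \<xi> * iexp (\<xi> \<bullet> y)) \<partial>lborel)"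
    unfolding fourier_integral_def by (rule integral_norm_bound)
  also have "\<dots> = (\<integral>\<xi>. norm (grushin_symbol x x0 t \<xi> :: complex) \<partial>(lborel :: (real ^ 'k) measure))"
    by (simp add: norm_mult)
  also have "\<dots> \<le> (\<integral>\<xi>. ?w (t *\<^sub>R \<xi>) \<partial>lborel)"
    using norm_grushin_symbol_le[OF t, of x x0]
    by (intro integral_mono_AE integrable_norm integrable_grushin_symbol t int) (simp only: eq)
  also have "\<dots> = grushin_weight TYPE('n) TYPE('k) / t ^ CARD('k)"
    unfolding grushin_weight_def using t by (subst integral_lborel_scaleR) auto
  finally show ?thesis .
qed

text \<open>The integrand is a product of normal densities of variance \<open>t\<close> centred at
  the coordinates of \<open>x0\<close>, each multiplied by \<open>sqrt (2 * pi * t)\<close>.\<close>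

lemma nn_integral_gaussian_shift:
  fixes x0 :: "real ^ 'n"
  assumes t: "t > 0"
  shows "(\<integral>\<^sup>+x. ennreal (exp (- ((norm (x - x0))\<^sup>2 / (2 * t)))) \<partial>lborel) = ennreal ((2 * pi * t) powr (real CARD('n) / 2))"
proof -
  have "exp (- ((norm (x - x0))\<^sup>2 / (2 * t))) =
      (\<Prod>b\<in>Basis. sqrt (2 * pi * t) * normal_density (x0 \<bullet> b) (sqrt t) (x \<bullet> b))" for x :: "real ^ 'n"
    using exp_norm_power2_eq_prod[of "1 / (2 * t)" "x - x0"] t
    by (simp add: normal_density_def inner_diff_left real_sqrt_mult)
  then have "(\<integral>\<^sup>+x. ennreal (exp (- ((norm (x - x0))\<^sup>2 / (2 * t)))) \<partial>lborel) =
      (\<integral>\<^sup>+x. (\<Prod>b\<in>Basis. ennreal (sqrt (2 * pi * t) * normal_density (x0 \<bullet> b) (sqrt t) (x \<bullet> b))) \<partial>lborel)"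
    using t by (simp add: prod_ennreal)
  also have "\<dots> = (\<Prod>b\<in>(Basis::(real ^ 'n) set). \<integral>\<^sup>+x. ennreal (sqrt (2 * pi * t) * normal_density (x0 \<bullet> b) (sqrt t) x) \<partial>lborel)"
    by (intro nn_integral_lborel_prod) auto
  also have "\<dots> = (\<Prod>b\<in>(Basis::(real ^ 'n) set). ennreal (sqrt (2 * pi * t)))"
    using t by (intro prod.cong refl) (subst nn_integral_eq_integral, auto)
  also have "\<dots> = ennreal (sqrt (2 * pi * t) ^ CARD('n))"
    using t by (simp add: ennreal_power)
  also have "sqrt (2 * pi * t) ^ CARD('n) = (2 * pi * t) powr (real CARD('n) / 2)"
    using t by (simp add: powr_half_sqrt[symmetric] powr_realpow[symmetric] powr_powr)
  finally show ?thesis .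
qed

text \<open>Joint measurability is part of the claim, since \<open>Lq_norm\<close> is infinite on
  non-measurable functions.\<close>

lemma measurable_grushin_heat_kernel [measurable]:
  "(\<lambda>(x :: real ^ 'n, y :: real ^ 'k). grushin_heat_kernel x x0 y t) \<in> borel_measurable borel"
  unfolding grushin_heat_kernel_def coth_def csch_def borel_prod[symmetric]
  by measurable

section \<open>The L^q bound from the endpoint estimates\<close>

theorem theorem2p3:
  fixes q :: ennreal
  assumes "1 \<le> q"
  shows "\<exists>C::real. C > 0 \<and> (\<forall>(x0 :: real ^ 'n) (t :: real). t > 0 \<longrightarrow>
           Lq_norm q lborel (\<lambda>(x :: real ^ 'n, y :: real ^ 'k). grushin_heat_kernel x x0 y t)
             \<le> ennreal (C * t powr (- ((real CARD('n) + 2 * real CARD('k)) / 2) * (1 - enn2real (1 / q)))))"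
proof -
  let ?c = "grushin_const TYPE('n) TYPE('k)"
  let ?p = "real CARD('n) / 2"
  let ?D = "(real CARD('n) + 2 * real CARD('k)) / 2"
  \<comment> \<open>\<open>S\<close> is the constant of the supremum bound and \<open>A\<close> that
    of the L^1 bound. The summand 1 makes \<open>S\<close> positive as soon as the weight is
    nonnegative.\<close>
  define S where "S = ?c * (grushin_weight TYPE('n) TYPE('k) + 1)"
  define A where "A = ?c * (2 * pi) ^ CARD('k) * (2 * pi) powr ?p"
  have c: "?c > 0"
    by (simp add: grushin_const_def)
  have W: "grushin_weight TYPE('n) TYPE('k) \<ge> 0"
    by (simp add: grushin_weight_def)
  have S: "S > 0" and A: "A > 0"
    using c W by (simp_all add: S_def A_def)
  have "Lq_norm q lborel (\<lambda>(x :: real ^ 'n, y :: real ^ 'k). grushin_heat_kernel x x0 y t)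
      \<le> ennreal (S powr (1 - enn2real (1 / q)) * A powr enn2real (1 / q) * t powr (- ?D * (1 - enn2real (1 / q))))"
    if t: "t > 0" for x0 :: "real ^ 'n" and t
  proof -
    have pt: "t powr - ?p * (1 / t ^ CARD('k)) = t powr - ?D"
    proof -
      have "1 / t ^ CARD('k) = t powr - real CARD('k)"
        using t by (simp add: powr_minus_divide powr_realpow)
      moreover have "- ?p + - real CARD('k) = - ?D"
        by (simp add: field_simps)
      ultimately show ?thesis
        by (simp only: flip: powr_add)
    qed
    have sup: "norm (grushin_heat_kernel x x0 y t) \<le> S * t powr - ?D" for x and y :: "real ^ 'k"
    proof -
      let ?e = "exp (- ((norm (x - x0))\<^sup>2 / (2 * t)))"
      have "norm (grushin_heat_kernel x x0 y t) =
          ?c * t powr - ?p * ?e * norm (fourier_integral (grushin_symbol x x0 t) y)"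
        using c by (simp add: grushin_heat_kernel_eq[OF t] norm_mult)
      \<comment> \<open>For the supremum the Gaussian in \<open>x - x0\<close> is bounded by 1; the
        L^1 estimate below keeps it to integrate over \<open>x\<close>.\<close>
      also have "\<dots> \<le> ?c * t powr - ?p * 1 * ((grushin_weight TYPE('n) TYPE('k) + 1) / t ^ CARD('k))"
      proof (intro mult_mono)
        show "norm (fourier_integral (grushin_symbol x x0 t) y) \<le> (grushin_weight TYPE('n) TYPE('k) + 1) / t ^ CARD('k)"
          by (rule order_trans[OF norm_fourier_grushin_symbol_le[OF t]]) (use t in \<open>simp add: divide_right_mono\<close>)
      qed (use c t in auto)
      also have "\<dots> = S * (t powr - ?p * (1 / t ^ CARD('k)))"
        by (simp add: S_def)
      finally show ?thesis
        unfolding pt .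
    qed
    have "(\<integral>\<^sup>+z. norm (case z of (x :: real ^ 'n, y :: real ^ 'k) \<Rightarrow> grushin_heat_kernel x x0 y t) \<partial>lborel) =
        (\<integral>\<^sup>+(x::real ^ 'n). (\<integral>\<^sup>+(y::real ^ 'k). norm (grushin_heat_kernel x x0 y t) \<partial>lborel) \<partial>lborel)"
    proof -
      have "(\<lambda>z. ennreal (norm (case z of (x :: real ^ 'n, y :: real ^ 'k) \<Rightarrow> grushin_heat_kernel x x0 y t))) \<in>
          borel_measurable (lborel \<Otimes>\<^sub>M lborel)"
        unfolding lborel_prod by measurable
      from lborel.nn_integral_fst[OF this] show ?thesis
        by (simp add: lborel_prod)
    qed
    also have "\<dots> \<le> (\<integral>\<^sup>+(x::real ^ 'n). ennreal (?c * t powr - ?p * (2 * pi) ^ CARD('k)) *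
        ennreal (exp (- ((norm (x - x0))\<^sup>2 / (2 * t)))) \<partial>lborel)"
    proof (rule nn_integral_mono)
      fix x :: "real ^ 'n"
      let ?e = "exp (- ((norm (x - x0))\<^sup>2 / (2 * t)))"
      let ?S = "grushin_symbol x x0 t :: real ^ 'k \<Rightarrow> complex"
      have [measurable]: "?S \<in> borel_measurable borel"
        by (rule fourier_multiplierD(1)[OF grushin_symbol_multiplier[OF t]])
      have "(\<integral>\<^sup>+(y::real ^ 'k). norm (grushin_heat_kernel x x0 y t) \<partial>lborel) =
          (\<integral>\<^sup>+y. ennreal (?c * t powr - ?p * ?e) * ennreal (norm (fourier_integral ?S y)) \<partial>lborel)"
        using c by (intro nn_integral_cong) (simp add: grushin_heat_kernel_eq[OF t] norm_mult ennreal_mult)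
      also have "\<dots> = ennreal (?c * t powr - ?p * ?e) * (\<integral>\<^sup>+y. norm (fourier_integral ?S y) \<partial>lborel)"
        by (rule nn_integral_cmult) measurable
      also have "\<dots> \<le> ennreal (?c * t powr - ?p * ?e) * ennreal ((2 * pi) ^ CARD('k))"
        using fourier_L1_le_multiplier[of ?S, OF grushin_symbol_multiplier[OF t] integrable_grushin_symbol[OF t]]
        by (intro mult_left_mono) (auto simp: fourier_L1_le_def)
      also have "\<dots> = ennreal (?c * t powr - ?p * (2 * pi) ^ CARD('k)) * ennreal ?e"
        using c by (simp add: mult_ac flip: ennreal_mult)
      finally show "(\<integral>\<^sup>+(y::real ^ 'k). norm (grushin_heat_kernel x x0 y t) \<partial>lborel) \<le> \<dots>" .
    qed
    also have "\<dots> = ennreal (?c * t powr - ?p * (2 * pi) ^ CARD('k)) * ennreal ((2 * pi * t) powr ?p)"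
      by (subst nn_integral_cmult) (simp_all add: nn_integral_gaussian_shift[OF t])
    also have "\<dots> = ennreal A"
    proof -
      \<comment> \<open>The mass of the Gaussian in \<open>x\<close> cancels the prefactor of the
        kernel, so the L^1 bound is uniform in \<open>t\<close>.\<close>
      have "t powr - ?p * t powr ?p = 1"
        using t by (simp flip: powr_add)
      then have "?c * t powr - ?p * (2 * pi) ^ CARD('k) * (2 * pi * t) powr ?p = A"
        using t by (simp add: A_def powr_mult)
      then show ?thesis
        using c by (simp flip: ennreal_mult)
    qed
    finally have L1: "(\<integral>\<^sup>+z. norm (case z of (x :: real ^ 'n, y :: real ^ 'k) \<Rightarrow> grushin_heat_kernel x x0 y t) \<partial>lborel) \<le> ennreal A" .
    have "Lq_norm q lborel (\<lambda>(x :: real ^ 'n, y :: real ^ 'k). grushin_heat_kernel x x0 y t)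
      \<le> ennreal ((S * t powr - ?D) powr (1 - enn2real (1 / q)) * A powr enn2real (1 / q))"
      by (rule Lq_norm_interpolation[OF assms _ _ _ L1 A]) (use sup S t in auto)
    also have "(S * t powr - ?D) powr (1 - enn2real (1 / q)) * A powr enn2real (1 / q) =
        S powr (1 - enn2real (1 / q)) * A powr enn2real (1 / q) * t powr (- ?D * (1 - enn2real (1 / q)))"
      using S by (simp only: powr_mult powr_powr mult_ac)
    finally show ?thesis .
  qed
  moreover have "S powr (1 - enn2real (1 / q)) * A powr enn2real (1 / q) > 0"
    using S A by simp
  ultimately show ?thesis
    by blast
qed

end
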